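(* Let $a,b\in P_{even}(\mathbb{N})$ (labels of alcoves in the dominant chamber for $\mathcal{D}/\mathcal{D}_+$). Then the parabolic Kazhdan–Lusztig polynomial $p_{a,b}$ for $\mathcal{D}/\mathcal{D}_+$ is given by the hypercube $h^a$: $$p_{a,b}=h^a_b .$$
   Context: $\mathbb{N}=\{1,2,\dots\}$; $P_{even}(\mathbb{N})$ is the set of finite subsets of $\mathbb{N}$ of even order; $v$ is a formal variable. **Group and alcoves.** $\mathcal{D}$ is the group acting on $\mathbb{R}^{\mathbb{N}}$ generated by the reflections $(ij)$ (swap $i$th and $j$th entries) and $(ij)_-$ (replace the entries $(x_i,x_j)$ by $(-x_j,-x_i)$), all $i<j$; $\mathcal{D}_+=\langle (ij)\rangle$. Let $v_-=(-1,-2,-3,\dots)$. Alcoves are identified with elements of the orbit $\mathcal{D}v_-$ (on which $\mathcal{D}$ acts simply transitively), the fundamental alcove being $v_-$. The dominant alcoves are $X^+=\{u\in\mathcal{D}v_-: u \text{ strictly decreasing}\}$; they are labelled by $P_{even}(\mathbb{N})$ via $u\mapsto\{$positive entries of $u\}$. The Coxeter generators are $S=\{(12)_-\}\cup\{(\alpha\ \alpha{+}1):\alpha\in\mathbb{N}\}$. The associated right action of $s\in S$ on $\mathcal{D}v_-$ is on the values of the entries: $(\alpha\ \alpha{+}1)$ interchanges the magnitudes $\alpha$ and $\alpha+1$ (keeping signs in place), and $(12)_-$ replaces values $1\to-2$, $2\to-1$, $-1\to2$, $-2\to1$. For an alcove $A$, $l(A)$ is the number of reflection hyperplanes of $\mathcal{D}$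 separating $A$ from $v_-$. The graph $G_a$ has vertex set $X^+$ and an edge $(A,As)$ whenever $A,As\in X^+$, $s\in S$ and $l(As)=l(A)+1$; it is rooted at $v_-$ and defines a partial order $<$ on $X^+$. **Polynomials.** The array $(p_{A,D})_{A,D\in X^+}$, with $p_A(D)=p_{A,D}$, is defined recursively. For the root $A=v_-$: $p_A(A)=1$ and $p_A(D)=0$ for $D\neq A$. For other $A$, choose an edge $(B,A)=(B,Bs)$ of $G_a$. For $D\in X^+$ put $p'_A(D)=v\,p_B(D)+p_B(Ds)$ if $(D,Ds)$ is an edge of $G_a$; $p'_A(D)=v^{-1}p_B(D)+p_B(Ds)$ if $(Ds,D)$ is an edge of $G_a$; $p'_A(D)=0$ if $Ds\notin X^+$. Then $p_A=p'_A-\sum_{D<A}p'_A(D)|_{v=0}\;p_D$. The result does not depend on the choice of edge. $p_{a,b}$ denotes $p_{A,B}$ for $A,B$ labelled by $a,b\in P_{even}(\mathbb{N})$. **Hypercubes.** For $a\in P_{even}(\mathbb{N})$ let $\mathbf{b}(a)$ be its indicator $0/1$ sequence, up to the last nonzero entry. Form a set $\Gamma^a$ of disjoint pairs (arcs) of positions: join each consecutive $01$ by an arc; ignoring the positions already paired, join each consecutive $01$ in the remaining sequence; iterate until the remaining sequence is a run of $1$s followed by a run of $0$s; finally join the remaining $1$s in adjacent pairs starting from the left (a last unpaired $1$, and the $0$s, stay single). The hypercube $h^a$ has one vertex for each subset $S'\subseteq\Gamma^a$, namely the set whose indicator sequence is obtained from $\mathbf{b}(a)$ by replacing, at the ends of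 each arc in $S'$, $01\to10$ (or $11\to00$ for a $11$-arc); its depth is $|S'|$. Distinct subsets give distinct vertices. Put $h^a_b=v^i$ if $b$ is a vertex of $h^a$ of depth $i$, and $h^a_b=0$ if $b$ is not a vertex of $h^a$. *)

theory Defs
  imports Complex_Main "HOL-Library.Poly_Mapping"
    "HOL-Algebra.Bij" "HOL-Algebra.Generated_Groups"
begin

section \<open>The group and its alcoves\<close>

text \<open>
  A point of \<open>\<real>\<^sup>\<nat>\<close> is a function \<open>nat \<Rightarrow> real\<close>; its entries are indexed from 0, so the value at
  \<open>i\<close> is the \<open>(i + 1)\<close>-st entry. Only coordinate positions are shifted in this way: the
  magnitudes occurring as entries, and hence the labels below, start at 1.
\<close>

type_synonym seq = "nat \<Rightarrow> real"

definition swap_refl :: "nat \<Rightarrow> nat \<Rightarrow> seq \<Rightarrow> seq" where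
  "swap_refl i j x = x(i := x j, j := x i)"

definition neg_swap_refl :: "nat \<Rightarrow> nat \<Rightarrow> seq \<Rightarrow> seq" where
  "neg_swap_refl i j x = x(i := - x j, j := - x i)"

definition reflections :: "(seq \<Rightarrow> seq) set" where
  "reflections = {swap_refl i j | i j. i < j} \<union> {neg_swap_refl i j | i j. i < j}"

definition Dgroup :: "(seq \<Rightarrow> seq) set" where
  "Dgroup = generate (BijGroup UNIV) reflections"

definition root_alcove :: seq where
  "root_alcove i = - real (Suc i)"

definition alcoves :: "seq set" where
  "alcoves = (\<lambda>w. w root_alcove) ` Dgroup"

definition dominant :: "seq set" where
  "dominant = {u \<in> alcoves. \<forall>i j. i < j \<longrightarrow> u j < u i}"

definition label :: "seq \<Rightarrow> nat set" where
  "label u = {n. 0 < n \<and> real n \<in> range u}"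

definition P_even :: "nat set set" where
  "P_even = {a. finite a \<and> 0 \<notin> a \<and> even (card a)}"

definition alcove_of :: "nat set \<Rightarrow> seq" where
  "alcove_of = the_inv_into dominant label"

text \<open>
  A Coxeter generator is represented by the map on values through which it acts on alcoves from
  the right, so that the alcove \<open>A s\<close> is \<open>s \<circ> A\<close>.
\<close>

definition adj_gen :: "nat \<Rightarrow> real \<Rightarrow> real" where
  "adj_gen \<alpha> x =
    (if \<bar>x\<bar> = real \<alpha> then sgn x * real (\<alpha> + 1)
     else if \<bar>x\<bar> = real (\<alpha> + 1) then sgn x * real \<alpha>
     else x)"

definition neg_gen :: "real \<Rightarrow> real" where
  "neg_gen x =
    (if x = 1 then -2 else if x = 2 then -1 else if x = -1 then 2 else if x = -2 then 1 else x)"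

definition coxeter_gens :: "(real \<Rightarrow> real) set" where
  "coxeter_gens = insert neg_gen (adj_gen ` {1..})"

text \<open>
  Every reflection in the group is conjugate to one of the generating reflections, and these are
  permuted by conjugation; so their fixed point sets are all the reflection hyperplanes.
\<close>

definition hyperplanes :: "seq set set" where
  "hyperplanes = (\<lambda>r. {x. r x = x}) ` reflections"

definition separates :: "seq set \<Rightarrow> seq \<Rightarrow> seq \<Rightarrow> bool" where
  "separates H x y \<longleftrightarrow>
    x \<notin> H \<and> y \<notin> H \<and> (\<exists>t\<in>{0..1}. (\<lambda>i. (1 - t) * x i + t * y i) \<in> H)"

definition len :: "seq \<Rightarrow> nat" where
  "len A = card {H \<in> hyperplanes. separates H A root_alcove}"

definition gen_edge :: "seq \<Rightarrow> (real \<Rightarrow> real) \<Rightarrow> seq \<Rightarrow> bool" where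
  "gen_edge B s A \<longleftrightarrow>
    s \<in> coxeter_gens \<and> B \<in> dominant \<and> A \<in> dominant \<and> A = s \<circ> B \<and> len A = len B + 1"

definition edges :: "(seq \<times> seq) set" where
  "edges = {(B, A). \<exists>s. gen_edge B s A}"

definition below :: "seq \<Rightarrow> seq set" where
  "below A = {D. (D, A) \<in> edges\<^sup>+}"


section \<open>The parabolic Kazhdan--Lusztig polynomials\<close>

text \<open>
  The ring \<open>\<int>[v, v\<inverse>]\<close> is the monoid algebra of \<open>\<int>\<close> with integer coefficients. The value of a
  polynomial at \<open>v = 0\<close> is its coefficient at exponent 0.
\<close>

type_synonym laurent = "int \<Rightarrow>\<^sub>0 int"

definition vv :: laurent where
  "vv = Poly_Mapping.single 1 1"

definition vv_inv :: laurent where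
  "vv_inv = Poly_Mapping.single (- 1) 1"

definition at_v0 :: "laurent \<Rightarrow> int" where
  "at_v0 f = Poly_Mapping.lookup f 0"

text \<open>
  The row \<open>p'\<^sub>A\<close> computed from the row \<open>f = p\<^sub>B\<close> and an edge from \<open>B\<close> to \<open>A = B s\<close>. The last case
  covers \<open>D s\<close> not being dominant, and also all \<open>D\<close> that are not dominant themselves.
\<close>

definition pre_row :: "(real \<Rightarrow> real) \<Rightarrow> (seq \<Rightarrow> laurent) \<Rightarrow> seq \<Rightarrow> laurent" where
  "pre_row s f D =
    (if (D, s \<circ> D) \<in> edges then vv * f D + f (s \<circ> D)
     else if (s \<circ> D, D) \<in> edges then vv_inv * f D + f (s \<circ> D)
     else 0)"

definition chosen_edge :: "seq \<Rightarrow> seq \<times> (real \<Rightarrow> real)" where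
  "chosen_edge A = (SOME (B, s). gen_edge B s A)"

lemma chosen_edge:
  assumes "\<exists>B s. gen_edge B s A"
  shows "gen_edge (fst (chosen_edge A)) (snd (chosen_edge A)) A"
proof -
  from assms have "\<exists>e. case e of (B, s) \<Rightarrow> gen_edge B s A"
    by auto
  then have "case chosen_edge A of (B, s) \<Rightarrow> gen_edge B s A"
    unfolding chosen_edge_def by (rule someI_ex)
  then show ?thesis
    by (simp add: case_prod_beta)
qed

lemma len_edge: "(B, A) \<in> edges \<Longrightarrow> len A = Suc (len B)"
  unfolding edges_def gen_edge_def mem_Collect_eq prod.case by (metis Suc_eq_plus1)

lemma len_less_if_below: "D \<in> below A \<Longrightarrow> len D < len A"
  unfolding below_def mem_Collect_eq
  by (induction rule: trancl_induct) (auto dest: len_edge)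

text \<open>
  \<open>kl A D\<close> is the array entry \<open>p\<^sub>A(D)\<close>. The final case is only there to make the function total:
  it concerns the \<open>A\<close> that are not dominant.
\<close>

function kl :: "seq \<Rightarrow> seq \<Rightarrow> laurent" where
  "kl A =
    (if A = root_alcove then (\<lambda>D. if D = root_alcove then 1 else 0)
     else if \<exists>B s. gen_edge B s A then
       (let p' = pre_row (snd (chosen_edge A)) (kl (fst (chosen_edge A)))
        in (\<lambda>D. p' D - (\<Sum>E\<in>below A. of_int (at_v0 (p' E)) * kl E D)))
     else (\<lambda>D. 0))"
  by pat_completeness auto
termination
proof (relation "measure len")
  fix A
  assume "\<exists>B s. gen_edge B s A"
  then show "(fst (chosen_edge A), A) \<in> measure len"
    using chosen_edge[of A] by (simp add: gen_edge_def)
qed (auto intro: len_less_if_below)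

declare kl.simps [simp del]

definition kl_poly :: "nat set \<Rightarrow> nat set \<Rightarrow> laurent" where
  "kl_poly a b = kl (alcove_of a) (alcove_of b)"


section \<open>Hypercubes\<close>

text \<open>
  A label \<open>a\<close> stands for its indicator sequence in positions \<open>1, 2, \<dots>\<close>. Given the arcs \<open>G\<close> formed
  so far, whose ends are \<open>Field G\<close>, one round joins every 01 that is consecutive when the
  positions already paired are ignored. As \<open>a\<close> is finite the rounds become stationary, so
  iterating until no such 01 remains amounts to taking the union over all rounds. Trailing zeros
  play no role since the right end of an arc lies in \<open>a\<close>.
\<close>

definition join01 :: "nat set \<Rightarrow> (nat \<times> nat) set \<Rightarrow> (nat \<times> nat) set" where
  "join01 a G = G \<union>
    {(i, j). 1 \<le> i \<and> i < j \<and> i \<notin> a \<and> j \<in> a \<and> i \<notin> Field G \<and> j \<notin> Field G \<and>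
      {i<..<j} \<subseteq> Field G}"

definition arcs01 :: "nat set \<Rightarrow> (nat \<times> nat) set" where
  "arcs01 a = (\<Union>n. (join01 a ^^ n) {})"

definition arcs11 :: "nat set \<Rightarrow> (nat \<times> nat) set" where
  "arcs11 a =
    (let r = sorted_list_of_set (a - Field (arcs01 a))
     in {(r ! (2 * m), r ! (2 * m + 1)) | m. 2 * m + 1 < length r})"

definition arcs :: "nat set \<Rightarrow> (nat \<times> nat) set" where
  "arcs a = arcs01 a \<union> arcs11 a"

text \<open>
  Both replacements, of 01 by 10 and of 11 by 00, invert the entries at the two ends of an arc.
\<close>

definition vertex :: "nat set \<Rightarrow> (nat \<times> nat) set \<Rightarrow> nat set" where
  "vertex a S = (a - Field S) \<union> (Field S - a)"

definition hypercube :: "nat set \<Rightarrow> nat set \<Rightarrow> laurent" where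
  "hypercube a b =
    (if \<exists>S. S \<subseteq> arcs a \<and> b = vertex a S
     then vv ^ card (THE S. S \<subseteq> arcs a \<and> b = vertex a S)
     else 0)"

end

theory Submission
  imports Defs
begin

text \<open>
  The hypercubes satisfy the recursion without any correction: if \<open>B \<rightarrow> A\<close> is an edge and \<open>p\<^sub>B\<close> is
  the hypercube of \<open>B\<close>, then the row \<open>p'\<^sub>A\<close> already is the hypercube of \<open>A\<close>, and this has constant
  coefficient 0 at every \<open>D \<noteq> A\<close>. Indeed the edge inverts two adjacent positions \<open>x\<close>, \<open>y\<close> that are not
  joined to each other in the arc diagram of \<open>B\<close>. The diagram of \<open>A\<close> arises from it by joining \<open>x\<close> to
  \<open>y\<close>, and the former partners of \<open>x\<close> and of \<open>y\<close> to each other (a single former partner stays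
  unpaired). A set of positions \<open>N\<close> avoiding \<open>x\<close> and \<open>y\<close> is a union of arcs of \<open>A\<close> iff exactly one of
  \<open>N\<close>, \<open>N \<union> {x, y}\<close> is a union of arcs of \<open>B\<close>, which is the identity \<open>p'\<^sub>A = h\<^sup>A\<close>.
\<close>

section \<open>Arc diagrams\<close>

text \<open>The joining rounds at the two ends of an edge are hard to compare round by round. The
  arcs are therefore described by conditions on an involution that mention no iteration. These hold
  for the empty label, survive every edge, and are compared with the rounds only once, in
  \<open>arcs_eq\<close>, which also shows that for a finite label they determine the involution.

  This matters because \<open>kl\<close> follows an edge picked by \<open>SOME\<close>: the
  induction has to accept whatever lower end turns up, together with some involution satisfying the
  conditions, instead of a preferred chain of edges from the root.

  The induction runs over labels, ordered by the sum of their elements, and not over alcoves,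
  because the same induction produces a dominant alcove for each prescribed label. The geometry
  enters only through the fact that an edge inverts two neighbouring bits of the label, and that its
  direction can be read off from these bits.\<close>

text \<open>
  An arc diagram is encoded by the involution \<open>\<tau>\<close> exchanging the ends of each arc and fixing the unpaired
  positions. The last two axioms say that 11-arcs are not nested inside other arcs, and that to the
  right of an unpaired position every 1 is the right end of a 01-arc.
\<close>

locale caps =
  fixes a :: "nat set" and \<tau> :: "nat \<Rightarrow> nat"
  assumes inv: "\<tau> (\<tau> k) = k"
    and zero: "0 \<notin> a" "\<tau> 0 = 0"
    and right: "k < \<tau> k \<Longrightarrow> \<tau> k \<in> a"
    and nest: "k < l \<Longrightarrow> l < \<tau> k \<Longrightarrow> \<tau> l \<noteq> l \<and> k < \<tau> l \<and> \<tau> l < \<tau> k"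
    and outer: "l < k \<Longrightarrow> k < \<tau> l \<Longrightarrow> k < \<tau> k \<Longrightarrow> k \<notin> a"
    and single: "\<tau> k = k \<Longrightarrow> 0 < k \<Longrightarrow> k < l \<Longrightarrow> l \<in> a \<Longrightarrow> \<tau> l < l \<and> \<tau> l \<notin> a"
begin

lemma left: "\<tau> k < k \<Longrightarrow> k \<in> a"
  using right[of "\<tau> k"] by (simp add: inv)

lemma inj: "\<tau> k = \<tau> l \<longleftrightarrow> k = l"
  by (metis inv)

lemma Field_arcs:
  assumes "G \<subseteq> {(i, j). i < j \<and> \<tau> i = j \<and> i \<notin> a}" "k \<in> Field G"
  shows "(k, \<tau> k) \<in> G \<and> k < \<tau> k \<or> (\<tau> k, k) \<in> G \<and> \<tau> k < k"
proof -
  from assms(2) obtain l where "(k, l) \<in> G \<or> (l, k) \<in> G" by (auto simp: Field_def)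
  then show ?thesis using assms(1) inv by auto
qed

text \<open>A 01 at \<open>i\<close>, \<open>j\<close> with everything between them already paired
  is forced to be an arc. If \<open>i\<close> were unpaired, \<open>single\<close> would make
  \<open>j\<close> a right end whose left end lies beyond \<open>i\<close>, against
  \<open>nest\<close>. Otherwise the partner of \<open>i\<close> is at \<open>j\<close> or to its
  right; in the latter case \<open>j\<close> would be a left end carrying a 1 inside the arc at
  \<open>i\<close>, against \<open>outer\<close>.\<close>

lemma arcs01_step:
  assumes G: "G \<subseteq> {(i, j). i < j \<and> \<tau> i = j \<and> i \<notin> a}"
  shows "join01 a G \<subseteq> {(i, j). i < j \<and> \<tau> i = j \<and> i \<notin> a}"
proof -
  have F: "\<tau> k \<in> Field G" if "k \<in> Field G" for k
    using Field_arcs[OF G that] by (auto simp: Field_def)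
  have F': "k \<in> Field G" if "\<tau> k \<in> Field G" for k
    using F[OF that] by (simp add: inv)
  have "\<tau> i = j" if "1 \<le> i" "i < j" "i \<notin> a" "j \<in> a" "i \<notin> Field G" "j \<notin> Field G"
    "{i<..<j} \<subseteq> Field G" for i j
  proof -
    have between: "k \<in> Field G" if "i < k" "k < j" for k
      using that \<open>{i<..<j} \<subseteq> Field G\<close> by auto
    have i: "i \<le> \<tau> i" using left[of i] that by force
    show ?thesis
    proof (cases "\<tau> i = i")
      case True
      then have "\<tau> j < j" using single[of i j] that by simp
      moreover have "\<tau> j \<noteq> i" using True inv that by (metis less_irrefl)
      ultimately have "\<tau> j < i" using between[of "\<tau> j"] F'[of j] that by force
      then show ?thesis using nest[of "\<tau> j" i] True that inv by simp
    next
      case False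
      then have "i < \<tau> i" using i by simp
      then have "j \<le> \<tau> i" using between[of "\<tau> i"] F'[of i] that by force
      moreover have False if "j < \<tau> i"
      proof -
        have "\<tau> j \<noteq> j" "i < \<tau> j" using nest[of i j] \<open>i < j\<close> that by auto
        then have "j < \<tau> j" using between[of "\<tau> j"] F'[of j] \<open>j \<notin> Field G\<close> by force
        then show False using outer[of i j] \<open>i < j\<close> \<open>j \<in> a\<close> that by simp
      qed
      ultimately show ?thesis by force
    qed
  qed
  then show ?thesis using G by (auto simp: join01_def)
qed

lemma arcs01_eq: "arcs01 a = {(i, j). i < j \<and> \<tau> i = j \<and> i \<notin> a}"
proof
  have sub: "(join01 a ^^ n) {} \<subseteq> {(i, j). i < j \<and> \<tau> i = j \<and> i \<notin> a}" for n
    by (induction n) (use arcs01_step in auto)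
  then show "arcs01 a \<subseteq> {(i, j). i < j \<and> \<tau> i = j \<and> i \<notin> a}"
    by (auto simp: arcs01_def)
  \<comment> \<open>As many rounds as the arc is long suffice: by \<open>nest\<close> and
    \<open>outer\<close> all positions inside it are ends of strictly shorter 01-arcs, which were
    found one round earlier.\<close>
  have "(i, \<tau> i) \<in> (join01 a ^^ n) {}" if "i < \<tau> i" "i \<notin> a" "\<tau> i - i \<le> n" for i n
    using that
  proof (induction n arbitrary: i)
    case 0
    then show ?case by simp
  next
    case (Suc n)
    let ?G = "(join01 a ^^ n) {}"
    have "l \<in> Field ?G" if "i < l" "l < \<tau> i" for l
    proof -
      have l: "\<tau> l \<noteq> l" "i < \<tau> l" "\<tau> l < \<tau> i" using nest[of i l] that by auto
      show ?thesis
      proof (cases "l < \<tau> l")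
        case True
        then have "l \<notin> a" using outer[of i l] that by simp
        then have "(l, \<tau> l) \<in> ?G" using Suc.IH[of l] True that l Suc.prems by simp
        then show ?thesis by (auto simp: Field_def)
      next
        case False
        then have less: "\<tau> l < \<tau> (\<tau> l)" using l inv by simp
        then have "\<tau> l \<notin> a" using outer[of i "\<tau> l"] l by simp
        then have "(\<tau> l, l) \<in> ?G" using Suc.IH[of "\<tau> l"] less l that Suc.prems inv by simp
        then show ?thesis by (auto simp: Field_def)
      qed
    qed
    then have between: "{i<..<\<tau> i} \<subseteq> Field ?G" by auto
    have "1 \<le> i" using Suc.prems(1) zero(2) by (cases i) auto
    have "(i, \<tau> i) \<in> join01 a ?G"
    proof (cases "i \<in> Field ?G \<or> \<tau> i \<in> Field ?G")
      case True
      then have "(i, \<tau> i) \<in> ?G"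
        using Field_arcs[OF sub[of n], of i] Field_arcs[OF sub[of n], of "\<tau> i"] Suc.prems(1)
        by (auto simp: inv)
      then show ?thesis by (simp add: join01_def)
    next
      case False
      then show ?thesis
        using between \<open>1 \<le> i\<close> Suc.prems(1,2) right[of i] unfolding join01_def by blast
    qed
    then show ?case by simp
  qed
  then show "{(i, j). i < j \<and> \<tau> i = j \<and> i \<notin> a} \<subseteq> arcs01 a"
    by (fastforce simp: arcs01_def)
qed

lemma arcs11_eq:
  assumes "finite a"
  shows "arcs11 a = {(i, j). i < j \<and> \<tau> i = j \<and> i \<in> a}"
proof -
  define R where "R = a - Field (arcs01 a)"
  define r where "r = sorted_list_of_set R"
  \<comment> \<open>The 1s left over are those that are unpaired or an end of a 11-arc; the
    condition on \<open>\<tau> k\<close> covers both.\<close>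
  have R: "k \<in> R \<longleftrightarrow> k \<in> a \<and> \<tau> k \<in> a" for k
  proof -
    have "k \<in> Field (arcs01 a) \<longleftrightarrow> \<tau> k \<noteq> k \<and> (\<tau> k \<notin> a)" if "k \<in> a"
      using that left[of "\<tau> k"] unfolding arcs01_eq Field_def Domain_iff Range_iff
      by (auto simp: inv) (metis inv linorder_neqE_nat)+
    then show ?thesis by (auto simp: R_def)
  qed
  have R\<tau>: "\<tau> k \<in> R" if "k \<in> R" for k
    using that by (simp add: R inv)
  have fin: "finite R" using assms by (simp add: R_def)
  have set_r: "set r = R" using fin by (simp add: r_def)
  have less_r: "r ! s < r ! t \<longleftrightarrow> s < t" if "s < length r" "t < length r" for s t
    using that sorted_wrt_nth_less[of "(<)" r] strict_sorted_list_of_set[of R]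
    by (metis linorder_neqE_nat order_less_asym r_def)
  have pair: "\<tau> (r ! (2 * m)) = r ! (2 * m + 1)" if "2 * m + 1 < length r" for m
    using that
  proof (induction m rule: less_induct)
    case (less m)
    define p q where "p = r ! (2 * m)" and "q = r ! (2 * m + 1)"
    have p: "p \<in> R" and q: "q \<in> R" and pq: "p < q"
      using less.prems less_r[of "2 * m" "2 * m + 1"] set_r by (auto simp: p_def q_def)
    have "\<tau> p \<noteq> p"
      using single[of p q] p q pq zero R by (metis gr_zeroI)
    obtain t where t: "t < length r" "r ! t = \<tau> p"
      using R\<tau>[OF p] set_r by (metis in_set_conv_nth)
    \<comment> \<open>The earlier leftover 1s are already paired among themselves.\<close>
    have "\<not> t < 2 * m"
    proof
      assume "t < 2 * m"
      define n where "n = t div 2"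
      have n: "n < m" "2 * n + 1 < length r" using \<open>t < 2 * m\<close> less.prems by (auto simp: n_def)
      have "t = 2 * n \<or> t = 2 * n + 1" by (auto simp: n_def)
      then have "\<tau> (r ! t) = r ! (2 * n + 1) \<or> \<tau> (r ! t) = r ! (2 * n)"
        using less.IH[OF n] inv by metis
      moreover have "r ! (2 * n + 1) < p" "r ! (2 * n) < p"
        using n less.prems less_r by (auto simp: p_def)
      ultimately show False using t inv by auto
    qed
    moreover have "t \<noteq> 2 * m" using t \<open>\<tau> p \<noteq> p\<close> by (auto simp: p_def)
    \<comment> \<open>If the arc from \<open>p\<close> passed over \<open>q\<close>, then
      \<open>q\<close> would be paired inside it and, by \<open>outer\<close>, with something to its
      left. That partner is a leftover 1 strictly between the neighbours \<open>p\<close> and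
      \<open>q\<close>.\<close>
    moreover have "\<not> 2 * m + 1 < t"
    proof
      assume "2 * m + 1 < t"
      then have "q < \<tau> p" using t less_r[of "2 * m + 1" t] less.prems by (simp add: q_def)
      then have n: "\<tau> q \<noteq> q" "p < \<tau> q" using nest[of p q] pq by auto
      have "\<not> q < \<tau> q" using outer[of p q] pq \<open>q < \<tau> p\<close> q R by auto
      obtain u where u: "u < length r" "r ! u = \<tau> q"
        using R\<tau>[OF q] set_r by (metis in_set_conv_nth)
      have "2 * m < u" "u < 2 * m + 1"
        using n \<open>\<not> q < \<tau> q\<close> u less_r less.prems by (auto simp: p_def q_def simp flip: less_r)
      then show False by simp
    qed
    ultimately have "t = 2 * m + 1" by simp
    then show ?case using t by (simp add: p_def)
  qed
  have "arcs11 a = {(r ! (2 * m), r ! (2 * m + 1)) | m. 2 * m + 1 < length r}"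
    unfolding arcs11_def Let_def r_def R_def ..
  also have "\<dots> = {(i, j). i < j \<and> \<tau> i = j \<and> i \<in> a}" (is "?L = ?R")
  proof
    show "?L \<subseteq> ?R"
    proof clarify
      fix m assume m: "2 * m + 1 < length r"
      then have "r ! (2 * m) \<in> R" using set_r by (metis Suc_eq_plus1 Suc_lessD nth_mem)
      then show "r ! (2 * m) < r ! (2 * m + 1) \<and> \<tau> (r ! (2 * m)) = r ! (2 * m + 1) \<and> r ! (2 * m) \<in> a"
        using pair[OF m] less_r[of "2 * m" "2 * m + 1"] m R by simp
    qed
    show "?R \<subseteq> ?L"
    proof clarify
      fix i assume i: "i < \<tau> i" "i \<in> a"
      then have "i \<in> R" "\<tau> i \<in> R" using R right inv by auto
      then obtain t u where t: "t < length r" "r ! t = i" and u: "u < length r" "r ! u = \<tau> i"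
        using set_r by (metis in_set_conv_nth)
      have "t < u" using i t u less_r by metis
      show "\<exists>m. (i, \<tau> i) = (r ! (2 * m), r ! (2 * m + 1)) \<and> 2 * m + 1 < length r"
      proof (cases "even t")
        case True
        then obtain m where "t = 2 * m" by blast
        then show ?thesis using pair[of m] t u \<open>t < u\<close> by (intro exI[of _ m]) auto
      next
        case False
        then obtain m where m: "t = 2 * m + 1" by (auto elim: oddE)
        then have "\<tau> i = r ! (2 * m)" using pair[of m] t inv by metis
        then show ?thesis using less_r[of "2 * m" t] t i m by auto
      qed
    qed
  qed
  finally show ?thesis .
qed

text \<open>For finite \<open>a\<close> the involution is thus determined by \<open>a\<close>, so it
  does not matter along which edges it was built.\<close>

lemma arcs_eq: "finite a \<Longrightarrow> arcs a = {(i, j). i < j \<and> \<tau> i = j}"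
  by (auto simp: arcs_def arcs01_eq arcs11_eq)

end

section \<open>Transport of arc diagrams along edges\<close>

definition rewire :: "nat \<Rightarrow> nat \<Rightarrow> (nat \<Rightarrow> nat) \<Rightarrow> nat \<Rightarrow> nat" where
  "rewire x y \<sigma> k =
    (if k = x then y else if k = y then x
     else if \<sigma> k = x then (if \<sigma> y = y then k else \<sigma> y)
     else if \<sigma> k = y then (if \<sigma> x = x then k else \<sigma> x)
     else \<sigma> k)"

lemma rewire_inv:
  assumes "\<And>k. \<sigma> (\<sigma> k) = k" "\<sigma> x \<noteq> y" "x \<noteq> y"
  shows "rewire x y \<sigma> (rewire x y \<sigma> k) = k"
  using assms(2,3) unfolding rewire_def by (smt (verit) assms(1))

text \<open>Since \<open>y = Suc x\<close> carries a 0, it is unpaired or a left end. Two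
  configurations of the former partners \<open>i\<close> of \<open>x\<close> and \<open>j\<close> of
  \<open>y\<close> remain. If \<open>i \<le> x\<close>, the new arc from \<open>i\<close> to
  \<open>j\<close> spans the two old ones side by side and encloses the arc from \<open>x\<close> to
  \<open>y\<close>. If \<open>x < i\<close>, a 11-arc from \<open>x\<close> encloses the 01-arc from
  \<open>y\<close>, and the new arc from \<open>j\<close> to \<open>i\<close> is a 11-arc to the
  right of \<open>y\<close>. An unpaired \<open>x\<close> or \<open>y\<close> is the degenerate case
  \<open>i = x\<close> or \<open>j = y\<close>.\<close>

lemma caps_shift:
  assumes "caps b \<sigma>" and x: "0 < x" "x \<in> b" "Suc x \<notin> b" and a: "a = insert (Suc x) (b - {x})"
  shows "\<sigma> x \<noteq> Suc x \<and> caps a (rewire x (Suc x) \<sigma>)"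
proof -
  interpret caps b \<sigma> by fact
  define y where "y = Suc x"
  define \<tau> where "\<tau> = rewire x y \<sigma>"
  define i j where "i = \<sigma> x" and "j = \<sigma> y"
  have [simp]: "\<sigma> x = i" "\<sigma> y = j" "\<sigma> i = x" "\<sigma> j = y"
    by (auto simp: i_def j_def inv)
  have [simp]: "\<sigma> k = x \<longleftrightarrow> k = i" "\<sigma> k = y \<longleftrightarrow> k = j" "\<sigma> k = i \<longleftrightarrow> k = x" "\<sigma> k = j \<longleftrightarrow> k = y" for k
    using inj[of k i] inj[of k j] inj[of k x] inj[of k y] by simp_all
  have y: "x < y" "\<And>k. x < k \<longleftrightarrow> y \<le> k" "\<And>k. k < y \<longleftrightarrow> k \<le> x" by (auto simp: y_def)
  have side: "z < x \<longleftrightarrow> z < y" "x < z \<longleftrightarrow> y < z" if "z \<noteq> x" "z \<noteq> y" for z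
    using that by (auto simp: y_def)
  have yb: "y \<notin> b" using x by (simp add: y_def)
  have iy: "i \<noteq> y"
    using right[of x] yb y(1) by auto
  then have jx: "j \<noteq> x" by (metis inv i_def j_def)
  have yj: "y \<le> j" using left[of y] yb by (metis j_def not_less)
  have jb: "j \<in> b" if "j \<noteq> y" using right[of y] yj that by auto
  have iy': "y < j" "j < i" if "x < i"
    using nest[of x y] y iy that yj by auto
  have ib: "i \<in> b" if "x < i" using right[of x] that by auto
  have \<tau>x: "\<tau> x = y" and \<tau>y: "\<tau> y = x" by (auto simp: \<tau>_def rewire_def)
  have \<tau>i: "\<tau> i = (if j = y then i else j)" if "i \<noteq> x"
    using that iy by (auto simp: \<tau>_def rewire_def)
  have \<tau>j: "\<tau> j = (if i = x then j else i)" if "j \<noteq> y"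
    using that jx by (auto simp: \<tau>_def rewire_def)
  have \<tau>: "\<tau> k = \<sigma> k" if "k \<noteq> x" "k \<noteq> y" "k \<noteq> i" "k \<noteq> j" for k
    using that by (simp add: \<tau>_def rewire_def)
  have \<sigma>ne: "\<sigma> k \<noteq> x" "\<sigma> k \<noteq> y" "\<sigma> k \<noteq> i" "\<sigma> k \<noteq> j" if "k \<noteq> x" "k \<noteq> y" "k \<noteq> i" "k \<noteq> j" for k
    using that by simp_all
  have a': "k \<in> a \<longleftrightarrow> k = y \<or> k \<in> b \<and> k \<noteq> x" for k by (auto simp: a y_def)
  \<comment> \<open>Either \<open>k\<close> is one of the four positions affected by rewiring, or it
    keeps its partner.\<close>
  have cases4: "P k" if "k = x \<Longrightarrow> P k" "k = y \<Longrightarrow> P k"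
    "k = i \<Longrightarrow> k \<noteq> x \<Longrightarrow> k \<noteq> y \<Longrightarrow> P k" "k = j \<Longrightarrow> k \<noteq> x \<Longrightarrow> k \<noteq> y \<Longrightarrow> P k"
    "k \<noteq> x \<Longrightarrow> k \<noteq> y \<Longrightarrow> k \<noteq> i \<Longrightarrow> k \<noteq> j \<Longrightarrow> P k" for P k
    using that by blast
  \<comment> \<open>Inside an arc the 1s behave as they do to the right of an unpaired position.
    This is what \<open>single\<close> requires when the arc from \<open>i\<close> to
    \<open>x\<close> is broken up and \<open>i\<close> becomes unpaired.\<close>
  have low: "\<sigma> l < l \<and> \<sigma> l \<notin> b" if "k < l" "l < \<sigma> k" "l \<in> b" for k l
  proof -
    have n: "\<sigma> l \<noteq> l" "k < \<sigma> l" "\<sigma> l < \<sigma> k" using nest[of k l] that by auto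
    then have "\<sigma> l < l" using outer[of k l] that by force
    then show ?thesis using outer[of k "\<sigma> l"] n inv by simp
  qed
  have i_arc: "\<tau> i = j" "i < j" "y < j" "i < x" if "i \<noteq> x" "i < \<tau> i"
  proof -
    show "\<tau> i = j" and ij: "i < j" and "y < j"
      using that \<tau>i yj by (auto split: if_splits)
    then have "\<not> x < i" using iy'(2) by auto
    then show "i < x" using that by simp
  qed
  have j_arc: "\<tau> j = i" "j < i" "y < j" "x < i" if "j \<noteq> y" "j < \<tau> j"
    using that \<tau>j yj y(1) by (auto split: if_splits)
  have "caps a \<tau>"
  proof
    show "\<tau> (\<tau> k) = k" for k
      unfolding \<tau>_def using inv iy y by (intro rewire_inv) auto
    show "0 \<notin> a" using zero x by (auto simp: a)
    show "\<tau> 0 = 0"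
    proof -
      have "0 \<noteq> i" "0 \<noteq> j" using zero(2) inv x(1) y(1) by (metis i_def j_def less_nat_zero_code)+
      then show ?thesis using zero(2) \<tau>[of 0] x(1) y(1) by simp
    qed
    show "\<tau> k \<in> a" if "k < \<tau> k" for k
    proof (rule cases4[of k])
      assume "k \<noteq> x" "k \<noteq> y" "k \<noteq> i" "k \<noteq> j"
      then show ?thesis using that \<tau> \<sigma>ne right a' by metis
    next
      assume "k = i" "k \<noteq> x" "k \<noteq> y"
      then show ?thesis using that \<tau>i jb a' jx by (auto split: if_splits)
    next
      assume "k = j" "k \<noteq> x" "k \<noteq> y"
      then show ?thesis using that \<tau>j ib a' iy yj y by (auto split: if_splits)
    qed (use \<tau>x \<tau>y a' that y in auto)
    show "\<tau> l \<noteq> l \<and> k < \<tau> l \<and> \<tau> l < \<tau> k" if "k < l" "l < \<tau> k" for k l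
    proof (rule cases4[of k])
      assume k: "k = i" "k \<noteq> x" "k \<noteq> y"
      then have ij: "\<tau> k = j" "i < j" "y < j" "i < x" using i_arc k that by auto
      show ?thesis
      proof (rule cases4[of l])
        assume l: "l \<noteq> x" "l \<noteq> y" "l \<noteq> i" "l \<noteq> j"
        then consider "l < x" | "y < l" using y by (metis linorder_neqE_nat less_le_not_le nle_le)
        then show ?thesis
          using nest[of i l] nest[of y l] that k ij \<tau>[OF l] y(1) by cases auto
      qed (use that k ij \<tau>x \<tau>y y(1) in auto)
    next
      assume k: "k = j" "k \<noteq> x" "k \<noteq> y"
      then have ij: "\<tau> k = i" "j < i" "y < j" using j_arc k that by auto
      then have "x < i" using y(1) by auto
      show ?thesis
      proof (rule cases4[of l])
        assume l: "l \<noteq> x" "l \<noteq> y" "l \<noteq> i" "l \<noteq> j"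
        have "\<sigma> l \<noteq> l" "x < \<sigma> l" "\<sigma> l < i" using nest[of x l] that ij k y(1) by auto
        moreover have "\<not> \<sigma> l < j"
          using nest[of y "\<sigma> l"] that k \<sigma>ne[OF l] \<open>x < \<sigma> l\<close> y inv[of l] by (metis \<open>\<sigma> y = j\<close> le_neq_implies_less less_asym)
        then have "j < \<sigma> l" using \<sigma>ne(4)[OF l] by (metis linorder_neqE_nat)
        ultimately show ?thesis using \<tau>[OF l] k ij by simp
      qed (use that k ij y(1) in auto)
    next
      assume k: "k \<noteq> x" "k \<noteq> y" "k \<noteq> i" "k \<noteq> j"
      note k' = \<tau>[OF k] \<sigma>ne[OF k]
      \<comment> \<open>As \<open>x\<close> and \<open>y\<close> are neighbours, an unchanged arc
        encloses both or neither.\<close>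
      have xy: "k < x \<and> x < \<sigma> k \<longleftrightarrow> k < y \<and> y < \<sigma> k" using side[of k] side[of "\<sigma> k"] k k' by metis
      have "i \<noteq> j" using y(1) inv by (metis i_def j_def less_irrefl)
      show ?thesis
      proof (rule cases4[of l])
        assume "l = i" "l \<noteq> x" "l \<noteq> y"
        then show ?thesis
          using nest[of k i] nest[of k y] xy that k' \<tau>i \<open>i \<noteq> j\<close> by auto
      next
        assume "l = j" "l \<noteq> x" "l \<noteq> y"
        then show ?thesis
          using nest[of k j] nest[of k x] xy that k' \<tau>j \<open>i \<noteq> j\<close> by auto
      qed (use that k' \<tau>x \<tau>y xy y(1) nest[of k l] \<tau> in auto)
    qed (use that \<tau>x \<tau>y y(2)[of l] y(1) in auto)
    show "k \<notin> a" if "l < k" "k < \<tau> l" "k < \<tau> k" for k l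
    proof (rule cases4[of k])
      assume k: "k = i" "k \<noteq> x" "k \<noteq> y"
      then have ij: "\<tau> k = j" "i < j" "i < x" using i_arc k that by auto
      have l: "l \<noteq> x" "l \<noteq> y" "l \<noteq> i" "l \<noteq> j" using ij k that y(1) by auto
      then have "i \<notin> b" using outer[of l i] ij k that \<tau> by auto
      then show ?thesis using k a' by simp
    next
      assume k: "k = j" "k \<noteq> x" "k \<noteq> y"
      then have ij: "\<tau> k = i" "j < i" "y < j" using j_arc k that by auto
      then have "x < i" using y(1) by auto
      have l: "l \<noteq> x" "l \<noteq> y" "l \<noteq> i" "l \<noteq> j" using ij k that \<tau>x \<tau>y y(1) by auto
      \<comment> \<open>An arc around \<open>j\<close> cannot start inside the arc from
        \<open>y\<close> to \<open>j\<close>, so it starts before \<open>x\<close>. It then encloses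
        \<open>x\<close>, which carries a 1 and was the left end of a 11-arc, against
        \<open>outer\<close>.\<close>
      have "j < \<sigma> l" "l < j" using that k \<tau>[OF l] by auto
      then have "\<not> y < l" using nest[of y l] by auto
      then have "l < x" using l y by (metis linorder_neqE_nat le_neq_implies_less)
      then show ?thesis using outer[of l x] \<open>x < i\<close> \<open>j < \<sigma> l\<close> ij x(2) y(1) by auto
    next
      assume k: "k \<noteq> x" "k \<noteq> y" "k \<noteq> i" "k \<noteq> j"
      note k' = \<tau>[OF k] \<sigma>ne[OF k]
      have "k \<notin> b"
      proof (rule cases4[of l])
        assume l: "l = i" "l \<noteq> x" "l \<noteq> y"
        then have ij: "\<tau> l = j" "i < j" "i < x" using i_arc l that by auto
        have "k < x \<or> y < k" using k y by (metis linorder_neqE_nat le_neq_implies_less)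
        then show ?thesis using outer[of i k] outer[of y k] that l ij k' by auto
      next
        assume l: "l = j" "l \<noteq> x" "l \<noteq> y"
        then have ij: "\<tau> l = i" "j < i" "y < j" using j_arc l that by auto
        then show ?thesis using outer[of x k] that l k' y(1) by auto
      next
        assume l: "l \<noteq> x" "l \<noteq> y" "l \<noteq> i" "l \<noteq> j"
        then show ?thesis using outer[of l k] that k' \<tau>[OF l] by simp
      qed (use that \<tau>x \<tau>y y(2)[of k] y(1) in auto)
      then show ?thesis using a' k by simp
    qed (use that \<tau>x \<tau>y y(1) a' in auto)
    show "\<tau> l < l \<and> \<tau> l \<notin> a" if "\<tau> k = k" "0 < k" "k < l" "l \<in> a" for k l
    proof (cases "l = y")
      case True
      then show ?thesis using \<tau>y y(1) a' by simp
    next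
      case False
      then have l: "l \<in> b" "l \<noteq> x" "l \<noteq> y" using that a' by auto
      have good: ?thesis if "\<sigma> l < l" "\<sigma> l \<notin> b" "l \<noteq> j" "l \<noteq> i"
        using that l \<tau>[of l] \<sigma>ne[of l] a' by simp
      show ?thesis
      proof (rule cases4[of k])
        assume k: "k = i" "k \<noteq> x" "k \<noteq> y"
        \<comment> \<open>The position \<open>i\<close> loses its partner only if \<open>y\<close>
          was unpaired. The 1s between \<open>i\<close> and \<open>x\<close> are then handled by
          \<open>low\<close>, those beyond \<open>y\<close> by the old unpaired position
          \<open>y\<close>.\<close>
        then have "j = y" using \<tau>i that y(1) inv by (metis i_def j_def less_irrefl)
        then have "i < x" using iy' k by force
        consider "l < x" | "y < l" using l y by (metis linorder_neqE_nat le_neq_implies_less)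
        then show ?thesis
          using low[of i l] single[of y l] that k l good \<open>j = y\<close> \<open>i < x\<close> y(1) by cases auto
      next
        assume k: "k = j" "k \<noteq> x" "k \<noteq> y"
        then have "i = x" using \<tau>j that y(1) inv by (metis i_def j_def less_irrefl)
        then show ?thesis
          using single[of x l] that k l good x(1) yj y(1) by auto
      next
        assume k: "k \<noteq> x" "k \<noteq> y" "k \<noteq> i" "k \<noteq> j"
        then have s: "\<sigma> k = k" using \<tau> that by simp
        then have sl: "\<sigma> l < l" "\<sigma> l \<notin> b" using single that l by auto
        show ?thesis
        proof (cases "l = j")
          case True
          \<comment> \<open>The unpaired \<open>k\<close> cannot lie inside the arc from
            \<open>y\<close> to \<open>j\<close>. Hence \<open>x\<close> lies to its right and is
            the right end of a 01-arc, so the new partner \<open>i\<close> of \<open>j\<close>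
            carries a 0.\<close>
          then have "k < x" using s nest[of y k] that k y
            by (metis \<open>\<sigma> y = j\<close> le_neq_implies_less linorder_neqE_nat)
          then have "i < x" "i \<notin> b" using single[of k x] s that x by auto
          then show ?thesis using True \<tau>j l a' yj y(1) by auto
        next
          case False
          moreover have "l \<noteq> i" using sl x by auto
          ultimately show ?thesis using good sl by simp
        qed
      qed (use that \<tau>x \<tau>y y(1) in auto)
    qed
  qed
  then show ?thesis using iy by (simp add: \<tau>_def y_def)
qed

text \<open>Both positions carry 0 in \<open>b\<close>. If 1 is paired with \<open>i\<close>, then 2
  lies inside that arc, so its partner \<open>j\<close> satisfies \<open>2 < j < i\<close>; both
  partners carry 1 and form a new 11-arc, not nested in anything. If 1 is unpaired, \<open>j\<close>
  becomes unpaired, and \<open>single\<close> for \<open>j\<close> is inherited from 1. The new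
  11-arc from 1 to 2 is outermost because only the fixed dummy position 0 lies to its left.\<close>

lemma caps_add:
  assumes "caps b \<sigma>" and b: "1 \<notin> b" "2 \<notin> b" and a: "a = insert 1 (insert 2 b)"
  shows "\<sigma> 1 \<noteq> 2 \<and> caps a (rewire 1 2 \<sigma>)"
proof -
  interpret caps b \<sigma> by fact
  define x y :: nat where "x = 1" and "y = 2"
  define \<tau> where "\<tau> = rewire x y \<sigma>"
  define i j where "i = \<sigma> x" and "j = \<sigma> y"
  have \<sigma>ij [simp]: "\<sigma> x = i" "\<sigma> y = j" "\<sigma> i = x" "\<sigma> j = y"
    by (auto simp: i_def j_def inv)
  have [simp]: "\<sigma> k = x \<longleftrightarrow> k = i" "\<sigma> k = y \<longleftrightarrow> k = j" "\<sigma> k = i \<longleftrightarrow> k = x" "\<sigma> k = j \<longleftrightarrow> k = y" for k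
    using inj[of k i] inj[of k j] inj[of k x] inj[of k y] by simp_all
  have xy: "0 < x" "x < y" by (auto simp: x_def y_def)
  have cases_le: "k \<noteq> x \<Longrightarrow> k \<noteq> y \<Longrightarrow> k = 0 \<or> y < k" for k unfolding x_def y_def by linarith
  have xb: "x \<notin> b" "y \<notin> b" using b by (auto simp: x_def y_def)
  have pos: "i \<noteq> 0" "j \<noteq> 0" by (metis \<sigma>ij zero(2) xy less_irrefl not_less_zero)+
  have iy: "i \<noteq> y" using right[of x] xb xy by auto
  then have jx: "j \<noteq> x" by (metis inv i_def j_def)
  have yj: "y < j" if "j \<noteq> y" using cases_le[of j] jx pos that by auto
  have ij: "y < j" "j < i" "j \<noteq> y" if "i \<noteq> x"
    using nest[of x y] cases_le[of i] iy pos that xy yj by auto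
  have jb: "j \<in> b" if "j \<noteq> y" using right[of y] yj that by auto
  have ib: "i \<in> b" if "i \<noteq> x" using right[of x] ij[OF that] xy by auto
  have \<tau>x: "\<tau> x = y" and \<tau>y: "\<tau> y = x" by (auto simp: \<tau>_def rewire_def)
  have \<tau>i: "\<tau> i = j" if "i \<noteq> x"
    using that ij[OF that] iy by (auto simp: \<tau>_def rewire_def)
  have \<tau>j: "\<tau> j = (if i = x then j else i)" if "j \<noteq> y"
    using that jx by (auto simp: \<tau>_def rewire_def)
  have \<tau>: "\<tau> k = \<sigma> k" if "k \<noteq> x" "k \<noteq> y" "k \<noteq> i" "k \<noteq> j" for k
    using that by (simp add: \<tau>_def rewire_def)
  have a': "k \<in> a \<longleftrightarrow> k = x \<or> k = y \<or> k \<in> b" for k by (auto simp: a x_def y_def)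
  have cases4: "P k" if "k = x \<Longrightarrow> P k" "k = y \<Longrightarrow> P k"
    "k = i \<Longrightarrow> i \<noteq> x \<Longrightarrow> P k" "k = j \<Longrightarrow> j \<noteq> y \<Longrightarrow> P k"
    "k \<noteq> x \<Longrightarrow> k \<noteq> y \<Longrightarrow> k \<noteq> i \<Longrightarrow> k \<noteq> j \<Longrightarrow> P k" for P k
    using that by blast
  have "i \<noteq> j" using jx ij(2) by (cases "i = x") auto
  have gt: "y < k" if "k \<noteq> x" "k \<noteq> y" "k < \<tau> k" for k
    using cases_le[of k] that zero(2) pos \<tau>[of 0] by auto
  have j_arc: "\<tau> j = i" "i \<noteq> x" if "j \<noteq> y" "j < \<tau> j"
    using that \<tau>j by (auto split: if_splits)
  have "caps a \<tau>"
  proof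
    show "\<tau> (\<tau> k) = k" for k
      unfolding \<tau>_def using inv iy xy by (intro rewire_inv) auto
    show "0 \<notin> a" using zero b by (auto simp: a)
    show "\<tau> 0 = 0" using zero(2) pos xy \<tau>[of 0] by simp
    show "\<tau> k \<in> a" if "k < \<tau> k" for k
      by (rule cases4[of k]) (use that \<tau>x \<tau>y a' \<tau> \<tau>i \<tau>j jb ib ij right in \<open>auto split: if_splits\<close>)
    show "\<tau> l \<noteq> l \<and> k < \<tau> l \<and> \<tau> l < \<tau> k" if "k < l" "l < \<tau> k" for k l
    proof (rule cases4[of k])
      assume k: "k = j" "j \<noteq> y"
      then have ji: "\<tau> j = i" "i \<noteq> x" using j_arc that by auto
      have l: "l \<noteq> x" "l \<noteq> y" "l \<noteq> i" "l \<noteq> j" using that k ji yj xy by auto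
      have "\<sigma> l \<noteq> l" "x < \<sigma> l" "\<sigma> l < i"
        using nest[of x l] that k ji ij xy by auto
      moreover have "\<not> \<sigma> l < j"
      proof
        assume "\<sigma> l < j"
        moreover have "\<sigma> l \<noteq> x" "\<sigma> l \<noteq> y" using l by auto
        ultimately have "y < \<sigma> l" using cases_le[of "\<sigma> l"] \<open>x < \<sigma> l\<close> by auto
        then show False using nest[of y "\<sigma> l"] \<open>\<sigma> l < j\<close> inv[of l] that k by auto
      qed
      moreover have "\<sigma> l \<noteq> j" using l by simp
      ultimately have "j < \<sigma> l" by linarith
      then show ?thesis using \<tau>[OF l] k ji \<open>\<sigma> l \<noteq> l\<close> \<open>\<sigma> l < i\<close> by simp
    next
      assume k: "k \<noteq> x" "k \<noteq> y" "k \<noteq> i" "k \<noteq> j"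
      then have "y < k" using gt that by simp
      then have "l \<noteq> x" "l \<noteq> y" using that xy by auto
      moreover have "l \<noteq> i" "l \<noteq> j" using nest[of k l] that \<tau>[OF k] \<open>y < k\<close> xy by auto
      ultimately show ?thesis using nest[of k l] that \<tau>[OF k] \<tau>[of l] by simp
    qed (use that \<tau>x \<tau>y xy cases_le[of l] \<tau>i ij in auto)
    show "k \<notin> a" if "l < k" "k < \<tau> l" "k < \<tau> k" for k l
    proof -
      have "l \<noteq> x" "l \<noteq> y" using that \<tau>x \<tau>y xy cases_le[of k] by auto
      then have "y < l" using that gt by simp
      then have k: "k \<noteq> x" "k \<noteq> y" using that xy by auto
      have "k \<notin> b"
      proof (rule cases4[of k])
        assume "k = j" "j \<noteq> y"
        then have kj: "k = j" "j \<noteq> y" "\<tau> j = i" "i \<noteq> x" using j_arc that by auto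
        then have "l \<noteq> i" using that ij by auto
        then have "\<tau> l = \<sigma> l" using \<tau> \<open>l \<noteq> x\<close> \<open>l \<noteq> y\<close> kj that by auto
        then show ?thesis using nest[of y l] that \<open>y < l\<close> kj by auto
      next
        assume k: "k \<noteq> x" "k \<noteq> y" "k \<noteq> i" "k \<noteq> j"
        show ?thesis
        proof (rule cases4[of l])
          assume "l = j" "j \<noteq> y"
          then have "l = j" "\<tau> j = i" "i \<noteq> x" using j_arc that by auto
          then show ?thesis using outer[of x k] that \<tau>[OF k] \<open>y < l\<close> xy by auto
        next
          assume l: "l \<noteq> x" "l \<noteq> y" "l \<noteq> i" "l \<noteq> j"
          then show ?thesis using outer[of l k] that \<tau>[OF k] \<tau>[OF l] by auto
        qed (use that \<open>l \<noteq> x\<close> \<open>l \<noteq> y\<close> \<tau>i ij in auto)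
      qed (use k that \<tau>i ij in auto)
      then show ?thesis using k a' by simp
    qed
    show "\<tau> l < l \<and> \<tau> l \<notin> a" if "\<tau> k = k" "0 < k" "k < l" "l \<in> a" for k l
    proof -
      have "y < k" by (metis \<tau>x \<tau>y cases_le less_irrefl that(1,2) xy(2))
      then have l: "l \<in> b" "l \<noteq> x" "l \<noteq> y" using that a' xy by auto
      have good: ?thesis if "\<sigma> l < l" "\<sigma> l \<notin> b" "l \<noteq> j" "l \<noteq> i"
        using that l \<tau>[of l] a' by simp
      show ?thesis
      proof (rule cases4[of k])
        assume "k = j" "j \<noteq> y"
        then have "i = x" using \<tau>j that \<open>i \<noteq> j\<close> by (auto split: if_splits)
        then show ?thesis
          using single[of x l] that l good \<open>k = j\<close> xy \<open>y < k\<close> by auto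
      next
        assume k: "k \<noteq> x" "k \<noteq> y" "k \<noteq> i" "k \<noteq> j"
        then have s: "\<sigma> k = k" using \<tau> that by simp
        then have "l \<noteq> i" "l \<noteq> j"
          using nest[of x k] nest[of y k] \<open>y < k\<close> xy that by auto
        then show ?thesis using good single[of k l] s that l by auto
      qed (use \<open>y < k\<close> \<tau>i that xy \<open>i \<noteq> j\<close> in auto)
    qed
  qed
  then show ?thesis using iy by (simp add: \<tau>_def x_def y_def i_def)
qed

section \<open>Hypercubes\<close>

text \<open>
  The vertices of the hypercube correspond to the unions \<open>M\<close> of arcs, and the depth is half the
  number of positions in \<open>M\<close>.
\<close>

definition saturated :: "(nat \<Rightarrow> nat) \<Rightarrow> nat set \<Rightarrow> bool" where
  "saturated \<tau> M \<longleftrightarrow> (\<forall>k\<in>M. \<tau> k \<noteq> k \<and> \<tau> k \<in> M)"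

definition weight :: "(nat \<Rightarrow> nat) \<Rightarrow> nat set \<Rightarrow> laurent" where
  "weight \<tau> M = (if saturated \<tau> M then vv ^ (card M div 2) else 0)"

lemma vv_mult_inv: "vv_inv * vv = 1"
  by (simp add: vv_inv_def vv_def mult_single)

lemma vv_power: "vv ^ n = Poly_Mapping.single (int n) 1"
  by (induction n) (simp_all add: vv_def mult_single)

lemma at_v0_vv_power: "0 < n \<Longrightarrow> at_v0 (vv ^ n) = 0"
  by (simp add: at_v0_def vv_power lookup_single)

context caps
begin

text \<open>Arcs are disjoint, so a set of arcs is recovered from the positions it covers. Together
  with \<open>Field_saturated\<close> this makes \<open>Field\<close> a bijection from sets of arcs
  to saturated sets, which gives the uniqueness behind \<open>THE\<close> in
  \<open>hypercube\<close>.\<close>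

lemma Field_matching:
  assumes "S \<subseteq> {(i, j). i < j \<and> \<tau> i = j}"
  shows "S = {(i, j). i < j \<and> \<tau> i = j \<and> i \<in> Field S}" and "saturated \<tau> (Field S)"
proof -
  have F: "(k, \<tau> k) \<in> S \<and> k < \<tau> k \<or> (\<tau> k, k) \<in> S \<and> \<tau> k < k" if k: "k \<in> Field S" for k
  proof -
    from k obtain l where "(k, l) \<in> S \<or> (l, k) \<in> S" by (auto simp: Field_def)
    then show ?thesis using assms inv by auto
  qed
  then show "S = {(i, j). i < j \<and> \<tau> i = j \<and> i \<in> Field S}"
    using assms by (fastforce simp: Field_def)
  show "saturated \<tau> (Field S)"
    using F by (fastforce simp: saturated_def Field_def)
qed

lemma Field_saturated:
  assumes "saturated \<tau> M"
  shows "Field {(i, j). i < j \<and> \<tau> i = j \<and> i \<in> M} = M" (is "Field ?S = M")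
proof
  show "Field ?S \<subseteq> M"
    using assms by (auto simp: Field_def saturated_def)
  show "M \<subseteq> Field ?S"
  proof
    fix k assume k: "k \<in> M"
    then have "\<tau> k \<noteq> k" "\<tau> k \<in> M" using assms by (auto simp: saturated_def)
    then have "(k, \<tau> k) \<in> ?S \<or> (\<tau> k, k) \<in> ?S" using k by (auto simp: inv)
    then show "k \<in> Field ?S" by (auto intro: FieldI1 FieldI2)
  qed
qed

lemma card_Field_matching:
  assumes "S \<subseteq> {(i, j). i < j \<and> \<tau> i = j}" and "finite S"
  shows "card (Field S) = 2 * card S"
proof -
  have S: "\<And>i j. (i, j) \<in> S \<Longrightarrow> i < j \<and> \<tau> i = j" using assms(1) by auto
  have "inj_on fst S" "inj_on snd S"
    using S inj by (auto simp: inj_on_def) metis+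
  moreover have "Domain S \<inter> Range S = {}"
  proof -
    have False if "(k, l) \<in> S" "(m, k) \<in> S" for k l m
      using S[OF that(1)] S[OF that(2)] inv[of m] by auto
    then show ?thesis by blast
  qed
  moreover have "finite (Domain S)" "finite (Range S)"
    using assms(2) by (auto simp: finite_Domain finite_Range)
  ultimately show ?thesis
    by (simp add: Field_def card_Un_disjoint Domain_fst Range_snd card_image)
qed

text \<open>Passing from \<open>a\<close> to \<open>vertex a S\<close> inverts exactly the positions
  in \<open>Field S\<close>, so \<open>S\<close> leads to \<open>b\<close> iff
  \<open>Field S\<close> is the symmetric difference of \<open>a\<close> and
  \<open>b\<close>.\<close>

lemma hypercube_eq_weight:
  assumes "finite a" "finite b"
  shows "hypercube a b = weight \<tau> (sym_diff a b)"
proof -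
  define M where "M = sym_diff a b"
  let ?G = "{(i, j). i < j \<and> \<tau> i = j}"
  let ?S = "{(i, j). i < j \<and> \<tau> i = j \<and> i \<in> M}"
  have vertex: "b = vertex a S \<longleftrightarrow> Field S = M" for S
    by (auto simp: vertex_def M_def)
  have arcs: "arcs a = ?G" using arcs_eq assms by simp
  show ?thesis
  proof (cases "saturated \<tau> M")
    case True
    have "S \<subseteq> ?G \<and> Field S = M \<longleftrightarrow> S = ?S" for S
      using Field_saturated[OF True] Field_matching(1)[of S] by blast
    then have eq: "S \<subseteq> arcs a \<and> b = vertex a S \<longleftrightarrow> S = ?S" for S
      by (simp add: arcs vertex)
    have subset: "?S \<subseteq> ?G" by blast
    have "finite ?S"
    proof (rule finite_subset)
      show "?S \<subseteq> M \<times> M" using True by (auto simp: saturated_def)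
    qed (use assms in \<open>simp add: M_def\<close>)
    then have "card ?S = card M div 2"
      using card_Field_matching[of ?S, OF subset] Field_saturated[OF True] by simp
    then show ?thesis using True by (simp add: hypercube_def eq weight_def flip: M_def)
  next
    case False
    then have "\<not> (\<exists>S. S \<subseteq> arcs a \<and> b = vertex a S)"
      using Field_matching(2) by (auto simp: arcs vertex)
    then show ?thesis
      unfolding hypercube_def weight_def M_def[symmetric] if_not_P[OF False] by (rule if_not_P)
  qed
qed

text \<open>Every arc has its right end in \<open>a\<close>. Finiteness keeps \<open>card\<close>
  from taking its default value 0, which would falsify the exponents in
  \<open>weight\<close>.\<close>

lemma finite_saturated:
  assumes "finite a" "saturated \<tau> M"
  shows "finite M"
proof (rule finite_subset)
  show "M \<subseteq> a \<union> \<tau> ` a"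
  proof
    fix k assume "k \<in> M"
    then have "k \<in> a \<or> \<tau> k \<in> a"
      using assms(2) right[of k] left[of k] by (metis linorder_neqE_nat saturated_def)
    then show "k \<in> a \<union> \<tau> ` a" using inv by (metis UnI1 UnI2 imageI)
  qed
qed (use assms in simp)

text \<open>This is why all the correction terms of the recursion vanish.\<close>

lemma at_v0_weight:
  assumes "finite a" "M \<noteq> {}"
  shows "at_v0 (weight \<tau> M) = 0"
proof (cases "saturated \<tau> M")
  case True
  obtain k where k: "k \<in> M" using assms by blast
  have "finite M" using finite_saturated assms True by blast
  moreover have "{k, \<tau> k} \<subseteq> M" "k \<noteq> \<tau> k" using k True by (auto simp: saturated_def)
  ultimately have "2 \<le> card M" by (metis card_2_iff card_mono)
  then show ?thesis using True by (simp add: weight_def at_v0_vv_power)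
qed (simp add: weight_def at_v0_def)

end

text \<open>Let \<open>i\<close>, \<open>j\<close> be the former partners of \<open>x\<close>,
  \<open>y\<close>. In the new diagram \<open>x\<close> and \<open>y\<close> form an arc, so adding
  both changes nothing, and \<open>i\<close>, \<open>j\<close> are joined or unpaired, so a
  saturated \<open>N\<close> contains both or neither. In the old diagram \<open>N\<close> can only
  be saturated if it contains neither, and \<open>N\<close> with \<open>x\<close> and
  \<open>y\<close> added only if it contains both.\<close>

lemma saturated_insert_rewire:
  assumes "\<And>k. \<sigma> (\<sigma> k) = k" "\<sigma> x \<noteq> y" "x \<noteq> y" "x \<notin> N" "y \<notin> N"
  shows "saturated (rewire x y \<sigma>) (insert x (insert y N)) \<longleftrightarrow> saturated (rewire x y \<sigma>) N"
    and "saturated (rewire x y \<sigma>) N \<longleftrightarrow> saturated \<sigma> N \<or> saturated \<sigma> (insert x (insert y N))"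
    and "\<not> (saturated \<sigma> N \<and> saturated \<sigma> (insert x (insert y N)))"
proof -
  let ?\<tau> = "rewire x y \<sigma>"
  note s = assms(1)
  show "saturated ?\<tau> (insert x (insert y N)) \<longleftrightarrow> saturated ?\<tau> N"
  proof -
    have "?\<tau> x = y" "?\<tau> y = x" using assms by (auto simp: rewire_def)
    moreover have "?\<tau> k \<noteq> x" "?\<tau> k \<noteq> y" if "k \<in> N" for k
      using that assms rewire_inv[OF s assms(2,3)] calculation by metis+
    ultimately show ?thesis using assms(3-) by (auto simp: saturated_def)
  qed
  show "\<not> (saturated \<sigma> N \<and> saturated \<sigma> (insert x (insert y N)))"
    using assms unfolding saturated_def by (metis insertE insertI1)
  show "saturated ?\<tau> N \<longleftrightarrow> saturated \<sigma> N \<or> saturated \<sigma> (insert x (insert y N))" (is "?L \<longleftrightarrow> ?R1 \<or> ?R2")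
  proof
    assume L: ?L
    have other: "?\<tau> k = \<sigma> k" if "k \<in> N" "k \<noteq> \<sigma> x" "k \<noteq> \<sigma> y" for k
    proof -
      have "\<sigma> k \<noteq> x" "\<sigma> k \<noteq> y" "k \<noteq> x" "k \<noteq> y" using that s[of k] assms(4,5) by auto
      then show ?thesis by (simp add: rewire_def)
    qed
    have i: "?\<tau> (\<sigma> x) = (if \<sigma> y = y then \<sigma> x else \<sigma> y)" if "\<sigma> x \<in> N"
      using that assms(2-) by (auto simp: rewire_def s)
    have "\<sigma> y \<noteq> x" using s[of y] assms(2) by auto
    then have j: "?\<tau> (\<sigma> y) = (if \<sigma> x = x then \<sigma> y else \<sigma> x)" if "\<sigma> y \<in> N"
      using that assms(2-) by (auto simp: rewire_def s)
    have "\<sigma> y \<in> N" if "\<sigma> x \<in> N"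
      using L i that unfolding saturated_def by metis
    moreover have "\<sigma> x \<in> N" if "\<sigma> y \<in> N"
      using L j that unfolding saturated_def by metis
    ultimately consider "\<sigma> x \<in> N" "\<sigma> y \<in> N" | "\<sigma> x \<notin> N" "\<sigma> y \<notin> N"
      by blast
    then show "?R1 \<or> ?R2"
    proof cases
      case 1
      then have ?R2 using L other s assms(4,5) unfolding saturated_def by (metis insert_iff)
      then show ?thesis ..
    next
      case 2
      then have ?R1 using L other s assms(4,5) unfolding saturated_def by metis
      then show ?thesis ..
    qed
  next
    assume "?R1 \<or> ?R2"
    then show ?L
    proof
      assume ?R1
      have "?\<tau> k = \<sigma> k" if "k \<in> N" for k
      proof -
        have "\<sigma> k \<in> N" using \<open>?R1\<close> that by (simp add: saturated_def)
        then have "\<sigma> k \<noteq> x" "\<sigma> k \<noteq> y" "k \<noteq> x" "k \<noteq> y" using that assms(4,5) by auto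
        then show ?thesis by (simp add: rewire_def)
      qed
      then show ?L using \<open>?R1\<close> by (simp add: saturated_def)
    next
      assume R: ?R2
      then have R': "\<sigma> x \<in> N" "\<sigma> y \<in> N" "\<sigma> x \<noteq> x" "\<sigma> y \<noteq> y"
        using assms unfolding saturated_def by (metis insert_iff)+
      show ?L unfolding saturated_def
      proof
        fix k assume k: "k \<in> N"
        then have "k \<noteq> x" "k \<noteq> y" "\<sigma> k \<noteq> k" "\<sigma> k \<in> insert x (insert y N)"
          using R assms(4,5) by (auto simp: saturated_def)
        moreover have "\<sigma> x \<noteq> \<sigma> y" using s assms(3) by metis
        ultimately consider "k = \<sigma> x" | "k = \<sigma> y" | "\<sigma> k \<noteq> x" "\<sigma> k \<noteq> y" "\<sigma> k \<in> N"
          by (metis insert_iff s)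
        then show "?\<tau> k \<noteq> k \<and> ?\<tau> k \<in> N"
          using R' \<open>k \<noteq> x\<close> \<open>k \<noteq> y\<close> \<open>\<sigma> k \<noteq> k\<close> \<open>\<sigma> x \<noteq> \<sigma> y\<close> assms(3)
          by cases (auto simp: rewire_def s)
      qed
    qed
  qed
qed

section \<open>Dominant alcoves\<close>

lemma reflection_involution: "r \<in> reflections \<Longrightarrow> r (r x) = x"
  by (auto simp: reflections_def swap_refl_def neg_swap_refl_def)

lemma reflections_Bij: "reflections \<subseteq> Bij UNIV"
proof
  fix r assume "r \<in> reflections"
  then have "bij r"
    using reflection_involution by (intro o_bij[of r r]) (auto simp: fun_eq_iff)
  then show "r \<in> Bij UNIV" by (simp add: Bij_def)
qed

lemma carrier_BijGroup: "carrier (BijGroup S) = Bij S"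
  by (simp add: BijGroup_def)

lemma Dgroup_Bij: "w \<in> Dgroup \<Longrightarrow> w \<in> Bij UNIV"
  using group.generate_in_carrier[OF group_BijGroup, of reflections UNIV w] reflections_Bij
  unfolding Dgroup_def carrier_BijGroup by blast

lemma BijGroup_mult: "v \<in> Bij UNIV \<Longrightarrow> w \<in> Bij UNIV \<Longrightarrow> v \<otimes>\<^bsub>BijGroup UNIV\<^esub> w = v \<circ> w"
  by (simp add: BijGroup_def compose_def fun_eq_iff)

lemma Dgroup_comp_reflection:
  assumes "w \<in> Dgroup" "r \<in> reflections"
  shows "w \<circ> r \<in> Dgroup"
proof -
  have "r \<in> generate (BijGroup UNIV) reflections" by (rule generate.incl) fact
  then have "w \<otimes>\<^bsub>BijGroup UNIV\<^esub> r \<in> Dgroup"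
    using assms(1) unfolding Dgroup_def by (intro generate.eng)
  then show ?thesis
    unfolding BijGroup_mult[OF Dgroup_Bij[OF assms(1)] subsetD[OF reflections_Bij assms(2)]] .
qed

section \<open>Signed permutations and the entries of an alcove\<close>

text \<open>These are the features of the group that alcoves inherit: each magnitude occurs exactly
  once, and only finitely many entries differ in sign from those of
  \<open>root_alcove\<close>.\<close>

definition signed_perm :: "(seq \<Rightarrow> seq) \<Rightarrow> bool" where
  "signed_perm w \<longleftrightarrow> (\<exists>\<pi> \<epsilon>. bij \<pi> \<and> (\<forall>i. \<epsilon> i = 1 \<or> \<epsilon> i = -1) \<and> finite {i. \<epsilon> i = -1} \<and>
     w = (\<lambda>x i. \<epsilon> i * x (\<pi> i)))"

lemma signed_perm_id: "signed_perm id"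
  unfolding signed_perm_def
  by (intro exI[of _ id] exI[of _ "\<lambda>_. 1"]) auto

lemma signed_perm_comp:
  assumes "signed_perm v" "signed_perm w"
  shows "signed_perm (v \<circ> w)"
proof -
  obtain \<pi> \<epsilon> where v: "bij \<pi>" "\<And>i. \<epsilon> i = 1 \<or> \<epsilon> i = -1" "finite {i. \<epsilon> i = -1}"
    "v = (\<lambda>x i. \<epsilon> i * x (\<pi> i))" using assms(1) by (auto simp: signed_perm_def)
  obtain \<rho> \<delta> where w: "bij \<rho>" "\<And>i. \<delta> i = 1 \<or> \<delta> i = -1" "finite {i. \<delta> i = -1}"
    "w = (\<lambda>x i. \<delta> i * x (\<rho> i))" using assms(2) by (auto simp: signed_perm_def)
  have "finite (\<pi> -` {i. \<delta> i = -1})"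
    using w(3) bij_is_inj[OF v(1)] by (rule finite_vimageI)
  then have "finite ({i. \<epsilon> i = -1} \<union> \<pi> -` {i. \<delta> i = -1})" using v(3) by simp
  moreover have "{i. \<epsilon> i * \<delta> (\<pi> i) = -1} \<subseteq> {i. \<epsilon> i = -1} \<union> \<pi> -` {i. \<delta> i = -1}"
  proof
    show "i \<in> {i. \<epsilon> i = -1} \<union> \<pi> -` {i. \<delta> i = -1}" if "i \<in> {i. \<epsilon> i * \<delta> (\<pi> i) = -1}" for i
      using that v(2)[of i] by auto
  qed
  ultimately have "finite {i. \<epsilon> i * \<delta> (\<pi> i) = -1}" by (rule rev_finite_subset)
  moreover have "\<epsilon> i * \<delta> (\<pi> i) = 1 \<or> \<epsilon> i * \<delta> (\<pi> i) = -1" for i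
    using v(2)[of i] w(2)[of "\<pi> i"] by auto
  moreover have "bij (\<rho> \<circ> \<pi>)" using v(1) w(1) by (rule bij_comp)
  ultimately show ?thesis
    unfolding signed_perm_def v(4) w(4)
    by (intro exI[of _ "\<rho> \<circ> \<pi>"] exI[of _ "\<lambda>i. \<epsilon> i * \<delta> (\<pi> i)"]) (auto simp: fun_eq_iff)
qed

lemma signed_perm_reflection:
  assumes "r \<in> reflections"
  shows "signed_perm r"
proof -
  obtain i j where ij: "i < j" and r: "r = swap_refl i j \<or> r = neg_swap_refl i j"
    using assms by (auto simp: reflections_def)
  define \<pi> where "\<pi> = id(i := j, j := i)"
  have "bij \<pi>" by (rule o_bij[of \<pi>]) (auto simp: \<pi>_def fun_eq_iff)
  from r show ?thesis
  proof
    assume "r = swap_refl i j"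
    then show ?thesis unfolding signed_perm_def
      using \<open>bij \<pi>\<close> by (intro exI[of _ \<pi>] exI[of _ "\<lambda>_. 1"]) (auto simp: fun_eq_iff swap_refl_def \<pi>_def)
  next
    assume "r = neg_swap_refl i j"
    moreover have "finite {k. (if k = i \<or> k = j then - 1 else 1 :: real) = - 1}"
      by (rule finite_subset[of _ "{i, j}"]) auto
    ultimately show ?thesis unfolding signed_perm_def
      using \<open>bij \<pi>\<close>
      by (intro exI[of _ \<pi>] exI[of _ "\<lambda>k. if k = i \<or> k = j then -1 else 1"])
        (auto simp: fun_eq_iff neg_swap_refl_def \<pi>_def)
  qed
qed

lemma signed_perm_Dgroup: "w \<in> Dgroup \<Longrightarrow> signed_perm w"
  unfolding Dgroup_def
proof (induction rule: generate.induct)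
  case one
  have "\<one>\<^bsub>BijGroup UNIV\<^esub> = (id :: seq \<Rightarrow> seq)" by (auto simp: BijGroup_def)
  then show ?case using signed_perm_id by metis
next
  case (incl h)
  then show ?case by (rule signed_perm_reflection)
next
  case (inv h)
  have "inv_into UNIV h = h"
    using reflection_involution[OF inv] by (intro inv_equality) auto
  then have "inv\<^bsub>BijGroup UNIV\<^esub> h = h"
    using inv_BijGroup[of h UNIV] inv reflections_Bij by (auto simp: restrict_def)
  then show ?case using signed_perm_reflection[OF inv] by simp
next
  case (eng h1 h2)
  then have "h1 \<otimes>\<^bsub>BijGroup UNIV\<^esub> h2 = h1 \<circ> h2"
    using Dgroup_Bij by (intro BijGroup_mult) (simp_all add: Dgroup_def)
  then show ?case using signed_perm_comp[OF eng.IH] by (simp only:)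
qed

lemma alcoveE:
  assumes "u \<in> alcoves"
  obtains \<pi> \<epsilon> where "bij \<pi>" "\<And>i. \<epsilon> i = 1 \<or> \<epsilon> i = -1" "finite {i. \<epsilon> i = -1}"
    "\<And>i. u i = - \<epsilon> i * real (Suc (\<pi> i))"
proof -
  obtain w where "w \<in> Dgroup" "u = w root_alcove" using assms by (auto simp: alcoves_def)
  then obtain \<pi> \<epsilon> where "bij \<pi>" "\<And>i. \<epsilon> i = 1 \<or> \<epsilon> i = -1" "finite {i. \<epsilon> i = -1}"
    "u = (\<lambda>i. \<epsilon> i * root_alcove (\<pi> i))"
    using signed_perm_Dgroup[of w] by (auto simp: signed_perm_def)
  then show ?thesis
    by (intro that[of \<pi> \<epsilon>]) (simp_all add: root_alcove_def algebra_simps)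
qed

lemma alcove_abs: "u \<in> alcoves \<Longrightarrow> \<exists>\<pi>. bij \<pi> \<and> (\<forall>i. \<bar>u i\<bar> = real (Suc (\<pi> i)))"
proof (erule alcoveE)
  fix \<pi> \<epsilon> assume "bij \<pi>" and \<epsilon>: "\<And>i. \<epsilon> i = 1 \<or> \<epsilon> i = -1" and u: "\<And>i. u i = - \<epsilon> i * real (Suc (\<pi> i))"
  have "\<bar>u i\<bar> = real (Suc (\<pi> i))" for i using \<epsilon>[of i] u[of i] by auto
  then show ?thesis using \<open>bij \<pi>\<close> by blast
qed

lemma alcove_int:
  assumes "u \<in> alcoves"
  obtains z :: int where "u i = of_int z" "z \<noteq> 0"
proof -
  obtain \<pi> where "\<bar>u i\<bar> = real (Suc (\<pi> i))" using alcove_abs[OF assms] by blast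
  then have "u i = of_int (int (Suc (\<pi> i))) \<or> u i = of_int (- int (Suc (\<pi> i)))" by auto
  then show ?thesis using that by fastforce
qed

lemma alcove_abs_inj:
  assumes "u \<in> alcoves" "\<bar>u i\<bar> = \<bar>u j\<bar>"
  shows "i = j"
proof -
  obtain \<pi> where "bij \<pi>" "\<And>i. \<bar>u i\<bar> = real (Suc (\<pi> i))" using alcove_abs[OF assms(1)] by blast
  then show ?thesis using assms(2) by (metis bij_is_inj injD nat.inject of_nat_eq_iff)
qed

lemma alcove_abs_surj:
  assumes "u \<in> alcoves" "0 < n"
  shows "\<exists>i. \<bar>u i\<bar> = real n"
proof -
  obtain \<pi> where \<pi>: "bij \<pi>" "\<And>i. \<bar>u i\<bar> = real (Suc (\<pi> i))" using alcove_abs[OF assms(1)] by blast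
  obtain i where "\<pi> i = n - 1" using bij_is_surj[OF \<pi>(1)] by (metis surjD)
  then show ?thesis using \<pi>(2)[of i] assms(2) by auto
qed

lemma alcove_finite_pos:
  assumes "u \<in> alcoves"
  shows "finite {i. 0 < u i}"
proof (rule alcoveE[OF assms])
  fix \<pi> \<epsilon> assume \<epsilon>: "\<And>i. \<epsilon> i = 1 \<or> \<epsilon> i = -1" "finite {i. \<epsilon> i = -1}" and
    u: "\<And>i. u i = - \<epsilon> i * real (Suc (\<pi> i))"
  have "\<epsilon> i = -1" if "0 < u i" for i
  proof (rule ccontr)
    assume "\<epsilon> i \<noteq> -1"
    then have "\<epsilon> i = 1" using \<epsilon>(1)[of i] by simp
    then have "u i = - real (Suc (\<pi> i))" by (simp only: u[of i] mult_minus_left mult_1)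
    then show False using that by linarith
  qed
  then have "{i. 0 < u i} \<subseteq> {i. \<epsilon> i = -1}" by blast
  then show ?thesis using \<epsilon>(2) by (rule finite_subset)
qed

text \<open>Exactly one of \<open>z\<close> and \<open>- z\<close> is an entry. Hence the label,
  which records the positive entries, fixes the whole set of entries.\<close>

lemma alcove_range_int:
  assumes "u \<in> alcoves" "z \<noteq> 0"
  shows "real_of_int z \<in> range u \<longleftrightarrow> (if 0 < z then nat z \<in> label u else nat (- z) \<notin> label u)"
proof -
  have "real_of_int (- z) \<in> range u \<longleftrightarrow> real_of_int z \<notin> range u"
  proof
    assume "real_of_int (- z) \<in> range u"
    then obtain i where i: "u i = real_of_int (- z)" by (metis imageE)
    show "real_of_int z \<notin> range u"
    proof
      assume "real_of_int z \<in> range u"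
      then obtain j where j: "u j = real_of_int z" by (metis imageE)
      then have "i = j" using alcove_abs_inj[OF assms(1), of i j] i by simp
      then show False using i j assms(2) by simp
    qed
  next
    assume z: "real_of_int z \<notin> range u"
    obtain i where "\<bar>u i\<bar> = real (nat \<bar>z\<bar>)" using alcove_abs_surj[OF assms(1), of "nat \<bar>z\<bar>"] assms(2) by auto
    then have "u i = real_of_int z \<or> u i = real_of_int (- z)" by (auto simp: abs_if split: if_splits)
    then show "real_of_int (- z) \<in> range u" using z by (metis rangeI)
  qed
  then show ?thesis using assms(2) by (auto simp: label_def not_less)
qed

lemma root_dominant: "root_alcove \<in> dominant"
proof -
  have "\<one>\<^bsub>BijGroup UNIV\<^esub> = (id :: seq \<Rightarrow> seq)" by (auto simp: BijGroup_def)
  then have "id \<in> Dgroup"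
    using generate.one[of "BijGroup UNIV" reflections] by (simp add: Dgroup_def)
  then have "root_alcove \<in> alcoves" unfolding alcoves_def by (rule rev_image_eqI) simp
  then show ?thesis by (simp add: dominant_def root_alcove_def)
qed

lemma label_root: "label root_alcove = {}"
  by (auto simp: label_def root_alcove_def)

lemma dominant_alcove: "u \<in> dominant \<Longrightarrow> u \<in> alcoves"
  and dominant_less: "u \<in> dominant \<Longrightarrow> i < j \<Longrightarrow> u j < u i"
  by (auto simp: dominant_def)

lemma dominant_less_iff: "u \<in> dominant \<Longrightarrow> u j < u i \<longleftrightarrow> i < j"
  by (metis dominant_less less_irrefl linorder_neqE_nat order_less_asym)

text \<open>If the sequences agree before \<open>n\<close>, the value \<open>u n\<close> occurs in
  \<open>w\<close> at an index not below \<open>n\<close>, so it is at most \<open>w n\<close>;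
  equality follows by symmetry.\<close>

lemma strictly_decreasing_eq:
  fixes u w :: "nat \<Rightarrow> 'a::linorder"
  assumes "\<And>i j. i < j \<Longrightarrow> u j < u i" "\<And>i j. i < j \<Longrightarrow> w j < w i" "range u = range w"
  shows "u = w"
proof
  have le: "v n \<le> v' n" if v: "\<And>i j. i < j \<Longrightarrow> v j < v i"
    and v': "\<And>i j. i < j \<Longrightarrow> v' j < v' i"
    and range: "range v = range v'" and eq: "\<And>k. k < n \<Longrightarrow> v k = v' k"
  for v v' :: "nat \<Rightarrow> 'a" and n
  proof -
    obtain m where m: "v n = v' m" using range by (metis rangeE rangeI)
    then have "\<not> m < n" using v[of m n] eq[of m] by auto
    then show ?thesis using v'[of n m] m by (cases "n = m") auto
  qed
  show "u n = w n" for n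
  proof (induction n rule: less_induct)
    case (less n)
    show ?case
      using le[of u w n] le[of w u n] assms less by (simp add: order_antisym)
  qed
qed

lemma dominant_eqI:
  assumes "u \<in> dominant" "w \<in> dominant" "label u = label w"
  shows "u = w"
proof -
  have "range u \<subseteq> range w" if u: "u \<in> alcoves" and w: "w \<in> alcoves" and eq: "label u = label w"
    for u w
  proof
    fix t assume "t \<in> range u"
    then obtain i where i: "t = u i" by blast
    obtain z where z: "u i = of_int z" "z \<noteq> 0" using alcove_int[OF u] .
    then show "t \<in> range w"
      using alcove_range_int[OF u z(2)] alcove_range_int[OF w z(2)] eq i by (metis rangeI)
  qed
  then have "range u = range w" using assms dominant_alcove by (simp add: subset_antisym)
  then show ?thesis
    using assms dominant_less by (intro strictly_decreasing_eq) auto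
qed

lemma alcove_of_label: "u \<in> dominant \<Longrightarrow> alcove_of (label u) = u"
  unfolding alcove_of_def by (intro the_inv_into_f_f inj_onI dominant_eqI)

section \<open>Length of a dominant alcove\<close>

text \<open>Both \<open>u\<close> and \<open>root_alcove\<close> are strictly decreasing, so no
  hyperplane of a \<open>swap_refl\<close> separates them. That of \<open>neg_swap_refl i j\<close>
  is the zero set of the sum of the entries at \<open>i\<close> and \<open>j\<close>, which is
  negative at \<open>root_alcove\<close>.\<close>

lemma len_eq_card:
  assumes "u \<in> dominant"
  shows "len u = card {(i, j). i < j \<and> 0 < u i + u j}"
proof -
  have u: "u \<in> alcoves" using assms by (rule dominant_alcove)
  define H where "H = (\<lambda>(i, j). {x. neg_swap_refl i j x = x})"
  have H: "x \<in> H (i, j) \<longleftrightarrow> x i = - x j" if "i < j" for i j x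
    using that by (auto simp: H_def neg_swap_refl_def fun_eq_iff)
  have sep: "separates (H (i, j)) u root_alcove \<longleftrightarrow> 0 < u i + u j" if "i < j" for i j
  proof -
    define c where "c = real (Suc i) + real (Suc j)"
    have ne: "u i \<noteq> - u j" using alcove_abs_inj[OF u, of i j] that by auto
    have "separates (H (i, j)) u root_alcove \<longleftrightarrow> (\<exists>t\<in>{0..1}. (1 - t) * (u i + u j) = t * c)"
      using that ne by (auto simp: separates_def H root_alcove_def c_def algebra_simps)
    also have "\<dots> \<longleftrightarrow> 0 < u i + u j"
    proof
      assume "\<exists>t\<in>{0..1}. (1 - t) * (u i + u j) = t * c"
      then obtain t where t: "0 \<le> t" "t \<le> 1" "(1 - t) * (u i + u j) = t * c" by auto
      show "0 < u i + u j"
      proof (rule ccontr)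
        assume "\<not> 0 < u i + u j"
        then have "u i + u j < 0" using ne by linarith
        have "0 \<le> t * c" using t by (simp add: c_def)
        then have "t = 1" using \<open>u i + u j < 0\<close> t by (smt (verit) mult_pos_neg)
        then show False using t by (simp add: c_def)
      qed
    next
      assume pos: "0 < u i + u j"
      have c: "0 < c" by (simp add: c_def)
      show "\<exists>t\<in>{0..1}. (1 - t) * (u i + u j) = t * c"
        \<comment> \<open>The witness is the zero in \<open>t\<close> of the linear function
          \<open>(1 - t) * (u i + u j) - t * c\<close>.\<close>
        by (rule bexI[of _ "(u i + u j) / (u i + u j + c)"]) (use pos c in \<open>auto simp: field_simps\<close>)
    qed
    finally show ?thesis .
  qed
  have swap: "\<not> separates {x. swap_refl i j x = x} u root_alcove" if "i < j" for i j
  proof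
    assume "separates {x. swap_refl i j x = x} u root_alcove"
    moreover have "swap_refl i j x = x \<longleftrightarrow> x i = x j" for x
      by (auto simp: swap_refl_def fun_eq_iff)
    ultimately obtain t where t: "0 \<le> t" "t \<le> 1"
      "(1 - t) * u i + t * root_alcove i = (1 - t) * u j + t * root_alcove j"
      by (auto simp: separates_def)
    then have "(1 - t) * (u i - u j) + t * (real j - real i) = 0"
      by (simp add: root_alcove_def algebra_simps)
    moreover have "0 < u i - u j" "0 < real j - real i" using dominant_less[OF assms that] that by auto
    ultimately show False using t
      by (smt (verit) mult_nonneg_nonneg mult_pos_pos)
  qed
  have "{K \<in> hyperplanes. separates K u root_alcove} = H ` {(i, j). i < j \<and> 0 < u i + u j}"
  proof (intro subset_antisym subsetI)
    fix K assume "K \<in> {K \<in> hyperplanes. separates K u root_alcove}"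
    then obtain r where K: "r \<in> reflections" "K = {x. r x = x}" "separates K u root_alcove"
      by (auto simp: hyperplanes_def)
    then obtain i j where ij: "i < j" "r = neg_swap_refl i j"
      using swap by (auto simp: reflections_def)
    then have "K = H (i, j)" using K by (simp add: H_def)
    then show "K \<in> H ` {(i, j). i < j \<and> 0 < u i + u j}" using sep ij K by blast
  next
    fix K assume "K \<in> H ` {(i, j). i < j \<and> 0 < u i + u j}"
    then obtain i j where ij: "i < j" "0 < u i + u j" "K = H (i, j)" by auto
    then have "K \<in> hyperplanes" by (auto simp: hyperplanes_def reflections_def H_def)
    then show "K \<in> {K \<in> hyperplanes. separates K u root_alcove}" using sep ij by simp
  qed
  moreover have "inj_on H {(i, j). i < j \<and> 0 < u i + u j}"
  proof (rule inj_onI)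
    fix p q assume "p \<in> {(i, j). i < j \<and> 0 < u i + u j}" "q \<in> {(i, j). i < j \<and> 0 < u i + u j}"
      and "H p = H q"
    then obtain i j k l where pq: "p = (i, j)" "q = (k, l)" and "i < j" "k < l"
      and eq: "H (i, j) = H (k, l)" by auto
    \<comment> \<open>The indices \<open>i\<close> and \<open>j\<close> can be read off from the
      hyperplane: in this point only the entries at \<open>i\<close> and \<open>j\<close>
      cancel.\<close>
    define x :: seq where "x = (\<lambda>_. 2)(i := 1, j := -1)"
    have "x \<in> H (i, j)" using \<open>i < j\<close> by (simp add: H x_def)
    then have "x k = - x l" using eq \<open>k < l\<close> by (simp add: H)
    then show "p = q" using \<open>i < j\<close> \<open>k < l\<close> unfolding pq by (auto simp: x_def split: if_splits)
  qed
  ultimately show ?thesis by (simp add: len_def card_image)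
qed

text \<open>In a positive sum the entry of larger magnitude is positive, which leaves finitely many
  choices for it, and it bounds the magnitude of the other.\<close>

lemma finite_pos_sums:
  assumes "u \<in> alcoves"
  shows "finite {(i, j). i < j \<and> 0 < u i + u j}"
proof (rule finite_subset)
  define B where "B m = {j. \<bar>u j\<bar> \<le> m}" for m
  let ?P = "SIGMA i:{i. 0 < u i}. B (u i)"
  show "{(i, j). i < j \<and> 0 < u i + u j} \<subseteq> ?P \<union> prod.swap ` ?P"
  proof (rule subsetI)
    fix p assume "p \<in> {(i, j). i < j \<and> 0 < u i + u j}"
    then obtain i j where p: "p = (i, j)" "0 < u i + u j" by auto
    then consider "0 < u i" "\<bar>u j\<bar> \<le> u i" | "0 < u j" "\<bar>u i\<bar> \<le> u j" by linarith
    then show "p \<in> ?P \<union> prod.swap ` ?P"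
      by cases (auto simp: p B_def intro: rev_image_eqI)
  qed
  have "finite (B m)" for m
  proof (rule inj_on_finite)
    show "inj_on (\<lambda>j. nat \<lfloor>\<bar>u j\<bar>\<rfloor>) (B m)"
    proof (rule inj_onI)
      fix j k assume "nat \<lfloor>\<bar>u j\<bar>\<rfloor> = nat \<lfloor>\<bar>u k\<bar>\<rfloor>"
      then have "\<bar>u j\<bar> = \<bar>u k\<bar>"
        using alcove_abs[OF assms] by (metis floor_of_nat nat_int)
      then show "j = k" by (rule alcove_abs_inj[OF assms])
    qed
    show "(\<lambda>j. nat \<lfloor>\<bar>u j\<bar>\<rfloor>) ` B m \<subseteq> {..nat \<lfloor>m\<rfloor>}"
      by (auto simp: B_def intro!: nat_mono floor_mono)
  qed simp
  then show "finite (?P \<union> prod.swap ` ?P)"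
    using alcove_finite_pos[OF assms] by simp
qed

section \<open>Coxeter generators acting on values\<close>

text \<open>
  Both kinds of Coxeter generators act on values as \<open>f \<mapsto> -g\<close>, \<open>g \<mapsto> -f\<close>, for \<open>f = \<alpha>\<close>, \<open>g = -(\<alpha> + 1)\<close>
  and for \<open>f = -1\<close>, \<open>g = -2\<close> respectively. The length goes up iff \<open>f\<close> and \<open>g\<close> occur among the entries.
\<close>

definition val_refl :: "'a \<Rightarrow> 'a \<Rightarrow> 'a \<Rightarrow> 'a::linordered_idom" where
  "val_refl f g z = (if z = f then - g else if z = g then - f
     else if z = - f then g else if z = - g then f else z)"

definition simple_pair :: "int \<Rightarrow> int \<Rightarrow> bool" where
  "simple_pair f g \<longleftrightarrow> f = -1 \<and> g = -2 \<or> 0 < f \<and> g = - (f + 1)"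

lemma val_refl_of_int: "val_refl (of_int f) (of_int g) (of_int z :: real) = of_int (val_refl f g z)"
  unfolding val_refl_def of_int_minus[symmetric] of_int_eq_iff by simp

text \<open>The displacement \<open>f + g\<close> is -1 for the adjacent generators and -3 for
  \<open>neg_gen\<close>.\<close>

lemma val_refl_shift:
  assumes "simple_pair f g"
  shows "z \<in> {f, g} \<Longrightarrow> val_refl f g z = z - (f + g)"
    and "z \<in> {- f, - g} \<Longrightarrow> val_refl f g z = z + (f + g)"
    and "z \<notin> {f, g, - f, - g} \<Longrightarrow> val_refl f g z = z"
proof -
  have "g < f" "f + g < 0" "f \<noteq> 0" "g \<noteq> 0" using assms by (auto simp: simple_pair_def)
  then have "g \<noteq> f" "f \<noteq> - g" "g \<noteq> - f" "- f \<noteq> f" "- g \<noteq> g" "- g \<noteq> - f" by linarith+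
  then show "z \<in> {f, g} \<Longrightarrow> val_refl f g z = z - (f + g)"
    and "z \<in> {- f, - g} \<Longrightarrow> val_refl f g z = z + (f + g)"
    and "z \<notin> {f, g, - f, - g} \<Longrightarrow> val_refl f g z = z"
    unfolding val_refl_def by auto
qed

text \<open>The move from \<open>w\<close> to \<open>w - (f + g)\<close> jumps only over 0 and
  values in \<open>{f, g, - f, - g}\<close>.\<close>

lemma simple_pair_gap:
  assumes "simple_pair f g" "z \<noteq> 0" "z \<notin> {f, g, - f, - g}" "w \<in> {f, g}"
  shows "w < z \<longleftrightarrow> w - (f + g) < z"
proof -
  consider "f = -1" "g = -2" | "0 < f" "g = - (f + 1)" using assms(1) by (auto simp: simple_pair_def)
  then show ?thesis
  proof cases
    case 1
    then have "z \<noteq> w + 1" "z \<noteq> w + 2" "z \<noteq> w + 3" using assms(2-4) by auto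
    then show ?thesis using 1 by simp linarith
  next
    case 2
    then have "z \<noteq> w + 1" using assms(3,4) by auto
    then show ?thesis using 2 by linarith
  qed
qed

text \<open>Under the last assumption all moves go in the same direction and by the same amount, and
  by \<open>simple_pair_gap\<close> a moving value overtakes no resting one.\<close>

lemma val_refl_less:
  assumes "simple_pair f g" "z \<noteq> 0" "w \<noteq> 0" "w < z"
    and "{z, w} \<inter> {f, g} = {} \<or> {z, w} \<inter> {-f, -g} = {}"
  shows "val_refl f g w < val_refl f g z"
proof -
  note shift = val_refl_shift[OF assms(1)]
  have neg: "f + g < 0" using assms(1) by (auto simp: simple_pair_def)
  from assms(5) show ?thesis
  proof
    assume d: "{z, w} \<inter> {f, g} = {}"
    define P where "P v \<longleftrightarrow> v \<in> {- f, - g}" for v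
    have z: "val_refl f g z = (if P z then z + (f + g) else z)"
      and w: "val_refl f g w = (if P w then w + (f + g) else w)"
      unfolding P_def using d shift by simp_all
    have "- w \<noteq> 0" "- w \<notin> {f, g, - f, - g}" "- z \<in> {f, g}" if "P z" "\<not> P w"
      using that d assms(3) by (auto simp: P_def)
    from simple_pair_gap[OF assms(1) this] have "w < z + (f + g)" if "P z" "\<not> P w"
      using that assms(4) by simp
    then show ?thesis unfolding z w using assms(4) neg by simp
  next
    assume d: "{z, w} \<inter> {- f, - g} = {}"
    define P where "P v \<longleftrightarrow> v \<in> {f, g}" for v
    have z: "val_refl f g z = (if P z then z - (f + g) else z)"
      and w: "val_refl f g w = (if P w then w - (f + g) else w)"
      unfolding P_def using d shift by simp_all
    have "z \<notin> {f, g, - f, - g}" "w \<in> {f, g}" if "P w" "\<not> P z"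
      using that d by (auto simp: P_def)
    from simple_pair_gap[OF assms(1,2) this] have "w - (f + g) < z" if "P w" "\<not> P z"
      using that assms(4) by simp
    then show ?thesis unfolding z w using assms(4) neg by simp
  qed
qed

text \<open>At most one of \<open>z\<close> and \<open>w\<close> moves. The sign of the sum compares
  this one with the negative of the other, which it does not overtake. So \<open>{f, g}\<close> is
  the only such pair whose sum can change sign.\<close>

lemma val_refl_sum_pos:
  assumes "simple_pair f g" "z \<noteq> 0" "w \<noteq> 0" "z \<noteq> w" "{z, w} \<noteq> {f, g}"
    and "{z, w} \<inter> {-f, -g} = {}"
  shows "0 < val_refl f g z + val_refl f g w \<longleftrightarrow> 0 < z + w"
proof -
  note shift = val_refl_shift[OF assms(1)]
  have gap: "0 < z - (f + g) + w \<longleftrightarrow> 0 < z + w"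
    if "z \<in> {f, g}" "w \<noteq> 0" "w \<notin> {f, g, - f, - g}" for z w
  proof -
    have "- w \<noteq> 0" "- w \<notin> {f, g, - f, - g}" using that(2,3) by auto
    from simple_pair_gap[OF assms(1) this that(1)] have "z < - w \<longleftrightarrow> z - (f + g) < - w" .
    moreover have "z \<noteq> - w" "z - (f + g) \<noteq> - w" using that(1,3) by auto
    ultimately show ?thesis by linarith
  qed
  consider "z \<in> {f, g}" "w \<notin> {f, g, - f, - g}" | "w \<in> {f, g}" "z \<notin> {f, g, - f, - g}"
    | "z \<notin> {f, g, - f, - g}" "w \<notin> {f, g, - f, - g}"
    using assms(4-6) by blast
  then show ?thesis
  proof cases
    case 1
    then show ?thesis using gap[OF 1(1) assms(3) 1(2)] shift(1)[OF 1(1)] shift(3)[OF 1(2)] by simp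
  next
    case 2
    then show ?thesis
      using gap[OF 2(1) assms(2) 2(2)] shift(1)[OF 2(1)] shift(3)[OF 2(2)] by (simp add: add.commute)
  next
    case 3
    then show ?thesis using shift(3) by simp
  qed
qed

lemma coxeter_gens_val_refl:
  "neg_gen = val_refl (of_int (-1)) (of_int (-2))"
  "0 < x \<Longrightarrow> adj_gen x = val_refl (of_int (int x)) (of_int (- (int x + 1)))"
  by (auto simp: fun_eq_iff neg_gen_def adj_gen_def val_refl_def abs_if sgn_if)

text \<open>The map on values is odd and hence commutes with signed permutations. At
  \<open>root_alcove\<close> it acts as a reflection \<open>r\<close> of the positions, so the right
  action replaces the group element \<open>w\<close> by \<open>w \<circ> r\<close>.\<close>

lemma alcove_comp_gen:
  assumes "simple_pair f g" "u \<in> alcoves"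
  shows "val_refl (of_int f) (of_int g) \<circ> u \<in> alcoves"
proof -
  let ?s = "val_refl (of_int f) (of_int g) :: real \<Rightarrow> real"
  obtain w where w: "w \<in> Dgroup" "u = w root_alcove" using assms(2) by (auto simp: alcoves_def)
  obtain \<pi> \<epsilon> where \<epsilon>: "\<And>i. \<epsilon> i = 1 \<or> \<epsilon> i = -1" and w': "w = (\<lambda>x i. \<epsilon> i * x (\<pi> i))"
    using signed_perm_Dgroup[OF w(1)] by (auto simp: signed_perm_def)
  have odd: "?s (- x) = - ?s x" for x
  proof -
    have "real_of_int f \<noteq> 0" "real_of_int g \<noteq> 0" "real_of_int f \<noteq> of_int g"
      "real_of_int f \<noteq> - of_int g"
      using assms(1) by (auto simp: simple_pair_def)
    then show ?thesis unfolding val_refl_def by (smt (verit))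
  qed
  have comm: "?s \<circ> w x = w (?s \<circ> x)" for x
  proof
    fix i
    show "(?s \<circ> w x) i = w (?s \<circ> x) i" using \<epsilon>[of i] odd by (auto simp: w')
  qed
  \<comment> \<open>Positions count from 0, so the magnitudes \<open>f\<close> and
    \<open>f + 1\<close> of \<open>root_alcove\<close> stand at positions \<open>f - 1\<close> and
    \<open>f\<close>.\<close>
  define r :: "seq \<Rightarrow> seq" where
    "r = (if f < 0 then neg_swap_refl 0 1 else swap_refl (nat f - 1) (nat f))"
  have "r \<in> reflections"
  proof (cases "f < 0")
    case True
    moreover have "neg_swap_refl 0 1 \<in> reflections"
      unfolding reflections_def using zero_less_one by blast
    ultimately show ?thesis by (simp add: r_def)
  next
    case False
    then have "nat f - 1 < nat f" using assms(1) by (auto simp: simple_pair_def)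
    then have "swap_refl (nat f - 1) (nat f) \<in> reflections" unfolding reflections_def by blast
    then show ?thesis using False by (simp add: r_def)
  qed
  moreover have "?s \<circ> root_alcove = r root_alcove"
  proof
    fix i
    consider "f = -1" "g = -2" | n where "f = int (Suc n)" "g = - int (Suc (Suc n))"
    proof -
      assume 1: "f = -1 \<Longrightarrow> g = -2 \<Longrightarrow> thesis"
        and 2: "\<And>n. f = int (Suc n) \<Longrightarrow> g = - int (Suc (Suc n)) \<Longrightarrow> thesis"
      show thesis using assms(1) 1 2[of "nat f - 1"] by (auto simp: simple_pair_def)
    qed
    then show "(?s \<circ> root_alcove) i = r root_alcove i"
      by cases (auto simp: root_alcove_def val_refl_def r_def neg_swap_refl_def swap_refl_def)
  qed
  ultimately have "?s \<circ> u = (w \<circ> r) root_alcove" "w \<circ> r \<in> Dgroup"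
    using comm Dgroup_comp_reflection[OF w(1)] by (simp_all add: w(2))
  then show ?thesis unfolding alcoves_def by (intro image_eqI[of _ _ "w \<circ> r"])
qed

section \<open>Edges of the graph in terms of labels\<close>

text \<open>
  At the lower and at the upper end of an edge given by \<open>s\<close>, the label meets \<open>{x, Suc x}\<close> in \<open>L\<close> and
  in \<open>H\<close> respectively.
\<close>

definition gen_bits :: "(real \<Rightarrow> real) \<Rightarrow> nat \<Rightarrow> nat set \<Rightarrow> nat set \<Rightarrow> bool" where
  "gen_bits s x L H \<longleftrightarrow> s = neg_gen \<and> x = 1 \<and> L = {} \<and> H = {1, Suc 1} \<or>
     s = adj_gen x \<and> 0 < x \<and> L = {x} \<and> H = {Suc x}"

lemma coxeter_gens_bits:
  assumes "s \<in> coxeter_gens"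
  shows "\<exists>x L H. gen_bits s x L H"
proof (cases "s = neg_gen")
  case True
  then have "gen_bits s 1 {} {1, Suc 1}" by (simp add: gen_bits_def)
  then show ?thesis by blast
next
  case False
  then obtain x where "0 < x" "s = adj_gen x" using assms by (auto simp: coxeter_gens_def Suc_le_eq)
  then have "gen_bits s x {x} {Suc x}" by (simp add: gen_bits_def)
  then show ?thesis by blast
qed

lemma gen_bits_coxeter: "gen_bits s x L H \<Longrightarrow> s \<in> coxeter_gens"
  by (auto simp: coxeter_gens_def gen_bits_def)

lemma val_refl_range:
  assumes "simple_pair f g"
  shows "real_of_int z \<in> range (val_refl (of_int f) (of_int g) \<circ> u) \<longleftrightarrow>
    real_of_int (val_refl f g z) \<in> range u"
proof -
  have inv: "val_refl (of_int f) (of_int g) (val_refl (of_int f) (of_int g) y) = (y :: real)" for y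
    using assms by (auto simp: val_refl_def simple_pair_def)
  let ?s = "val_refl (of_int f) (of_int g) :: real \<Rightarrow> real"
  have "y \<in> range (?s \<circ> u) \<longleftrightarrow> ?s y \<in> range u" for y
  proof
    assume "y \<in> range (?s \<circ> u)"
    then obtain i where "y = ?s (u i)" by auto
    then have "?s y = u i" by (simp only: inv)
    then show "?s y \<in> range u" by simp
  next
    assume "?s y \<in> range u"
    then obtain i where "?s y = u i" by auto
    then have "y = ?s (u i)" by (metis inv)
    then show "y \<in> range (?s \<circ> u)" by simp
  qed
  then show ?thesis by (simp only: val_refl_of_int)
qed

lemma val_refl_dominant:
  assumes "simple_pair f g" "u \<in> dominant"
    and "(\<forall>i. u i \<noteq> of_int f \<and> u i \<noteq> of_int g) \<or> (\<forall>i. u i \<noteq> of_int (- f) \<and> u i \<noteq> of_int (- g))"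
  shows "val_refl (of_int f) (of_int g) \<circ> u \<in> dominant"
proof -
  have u: "u \<in> alcoves" using assms(2) by (rule dominant_alcove)
  have "val_refl (of_int f) (of_int g) (u j) < val_refl (of_int f) (of_int g) (u i)" if "i < j" for i j
  proof -
    obtain z where z: "u i = of_int z" "z \<noteq> 0" using alcove_int[OF u] .
    obtain w where w: "u j = of_int w" "w \<noteq> 0" using alcove_int[OF u] .
    have "w < z" using dominant_less[OF assms(2) that] z w by simp
    moreover have "{z, w} \<inter> {f, g} = {} \<or> {z, w} \<inter> {- f, - g} = {}"
      using assms(3) z(1) w(1) by auto
    ultimately show ?thesis
      using val_refl_less[OF assms(1) z(2) w(2)] z(1) w(1) by (simp add: val_refl_of_int)
  qed
  then show ?thesis using alcove_comp_gen[OF assms(1) u] by (simp add: dominant_def)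
qed

text \<open>With \<open>f\<close> and \<open>g\<close> among the entries, their negatives are not,
  so the order is preserved. Exactly one pair sum changes sign, from \<open>f + g\<close> to
  \<open>- (f + g)\<close>; it adds one separating hyperplane.\<close>

lemma val_refl_low:
  assumes "simple_pair f g" "u \<in> dominant" "of_int f \<in> range u" "of_int g \<in> range u"
  defines "s \<equiv> val_refl (of_int f) (of_int g)"
  shows "s \<circ> u \<in> dominant" "len (s \<circ> u) = Suc (len u)"
proof -
  have u: "u \<in> alcoves" using assms by (simp add: dominant_alcove)
  have fg: "g < f" "f + g < 0" "f \<noteq> 0" "g \<noteq> 0" using assms(1) by (auto simp: simple_pair_def)
  obtain p q where p: "u p = of_int f" and q: "u q = of_int g"
    using assms(3,4) by (metis imageE)
  have "u q < u p" using p q fg by simp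
  then have "p < q" using dominant_less_iff[OF assms(2)] by simp
  have not_f: "z \<noteq> - f" if "u i = of_int z" for i z
    using alcove_abs_inj[OF u, of i p] that p fg by auto
  have not_g: "z \<noteq> - g" if "u i = of_int z" for i z
    using alcove_abs_inj[OF u, of i q] that q fg by auto
  show dom: "s \<circ> u \<in> dominant"
    unfolding s_def using not_f not_g by (intro val_refl_dominant assms) metis
  have iff: "0 < s (u i) + s (u j) \<longleftrightarrow> (i, j) = (p, q) \<or> 0 < u i + u j" if "i < j" for i j
  proof (cases "(i, j) = (p, q)")
    case True
    then show ?thesis using p q fg by (simp add: s_def val_refl_of_int) (simp add: val_refl_def)
  next
    case False
    obtain z where z: "u i = of_int z" "z \<noteq> 0" using alcove_int[OF u] .
    obtain w where w: "u j = of_int w" "w \<noteq> 0" using alcove_int[OF u] .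
    have eqs: "z = f \<Longrightarrow> i = p" "z = g \<Longrightarrow> i = q" "w = f \<Longrightarrow> j = p" "w = g \<Longrightarrow> j = q"
      using alcove_abs_inj[OF u] p q z w by metis+
    have "{z, w} \<noteq> {f, g}"
    proof
      assume "{z, w} = {f, g}"
      then have "z = f \<and> w = g \<or> z = g \<and> w = f" by (simp add: doubleton_eq_iff)
      then show False using False eqs that \<open>p < q\<close> by auto
    qed
    moreover have "z \<noteq> w"
      using alcove_abs_inj[OF u, of i j] z w that by auto
    ultimately have "0 < val_refl f g z + val_refl f g w \<longleftrightarrow> 0 < z + w"
      using val_refl_sum_pos[OF assms(1) z(2) w(2)] not_f not_g z(1) w(1) by auto
    then show ?thesis using False z w by (auto simp: s_def val_refl_of_int simp flip: of_int_add)
  qed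
  have "{(i, j). i < j \<and> 0 < (s \<circ> u) i + (s \<circ> u) j} = insert (p, q) {(i, j). i < j \<and> 0 < u i + u j}"
    using iff \<open>p < q\<close> by auto
  moreover have "(p, q) \<notin> {(i, j). i < j \<and> 0 < u i + u j}"
    using p q fg by (simp flip: of_int_add)
  ultimately show "len (s \<circ> u) = Suc (len u)"
    using finite_pos_sums[OF u] by (simp add: len_eq_card[OF dom] len_eq_card[OF assms(2)])
qed

lemma val_refl_high:
  assumes "simple_pair f g" "u \<in> dominant" "of_int (- f) \<in> range u" "of_int (- g) \<in> range u"
  defines "s \<equiv> val_refl (of_int f) (of_int g)"
  shows "s \<circ> u \<in> dominant" "len u = Suc (len (s \<circ> u))"
proof -
  have u: "u \<in> alcoves" using assms by (simp add: dominant_alcove)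
  have fg: "f \<noteq> 0" "g \<noteq> 0" using assms(1) by (auto simp: simple_pair_def)
  obtain p q where p: "u p = of_int (- f)" and q: "u q = of_int (- g)"
    using assms(3,4) by (metis imageE)
  have not_f: "z \<noteq> f" if "u i = of_int z" for i z
    using alcove_abs_inj[OF u, of i p] that p fg by auto
  have not_g: "z \<noteq> g" if "u i = of_int z" for i z
    using alcove_abs_inj[OF u, of i q] that q fg by auto
  show dom: "s \<circ> u \<in> dominant"
    unfolding s_def using not_f not_g by (intro val_refl_dominant assms) metis
  have "val_refl f g f = - g" "val_refl f g g = - f"
    using val_refl_shift(1)[OF assms(1), of f] val_refl_shift(1)[OF assms(1), of g] by simp_all
  then have "of_int f \<in> range (s \<circ> u)" "of_int g \<in> range (s \<circ> u)"
    using assms(3,4) unfolding s_def val_refl_range[OF assms(1)] by simp_all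
  moreover have "s \<circ> (s \<circ> u) = u"
    using assms(1) by (auto simp: fun_eq_iff s_def val_refl_def simple_pair_def)
  ultimately show "len u = Suc (len (s \<circ> u))"
    using val_refl_low(2)[OF assms(1) dom] by (simp add: s_def)
qed

text \<open>The generator exchanges \<open>f\<close> with \<open>- g\<close>, and \<open>- f\<close>
  with \<open>g\<close>. If both members of such a pair are entries, their order is
  reversed.\<close>

lemma val_refl_mixed:
  assumes "simple_pair f g" "u \<in> dominant"
    and "of_int f \<in> range u \<and> of_int (- g) \<in> range u \<or> of_int (- f) \<in> range u \<and> of_int g \<in> range u"
  shows "val_refl (of_int f) (of_int g) \<circ> u \<notin> dominant"
proof
  let ?s = "val_refl (of_int f) (of_int g)"
  assume dom: "?s \<circ> u \<in> dominant"
  note shift = val_refl_shift[OF assms(1)]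
  have vals: "val_refl f g f = - g" "val_refl f g (- g) = f" "val_refl f g (- f) = g"
    "val_refl f g g = - f"
    using shift(1)[of f] shift(2)[of "- g"] shift(2)[of "- f"] shift(1)[of g] by simp_all
  have less: "f < - g" "g < - f" using assms(1) by (auto simp: simple_pair_def)
  have False if zw: "of_int z \<in> range u" "of_int w \<in> range u" "w < z" "val_refl f g z = w"
    "val_refl f g w = z" for z w
  proof -
    obtain i j where ij: "u i = of_int z" "u j = of_int w" using zw(1,2) by (metis imageE)
    then have "i < j" using dominant_less_iff[OF assms(2), of j i] that by simp
    then show False
      using dominant_less[OF dom, of i j] ij that by (simp add: val_refl_of_int)
  qed
  then show False using assms(3) vals less by blast
qed

lemma gen_bits_val_refl:
  assumes "gen_bits s x L H"
  obtains f g where "simple_pair f g" "s = val_refl (of_int f) (of_int g)"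
    "f = -1 \<and> g = -2 \<and> x = 1 \<and> L = {} \<and> H = {1, Suc 1} \<or>
      f = int x \<and> g = - (int x + 1) \<and> 0 < x \<and> L = {x} \<and> H = {Suc x}"
  using assms unfolding gen_bits_def
proof
  assume "s = neg_gen \<and> x = 1 \<and> L = {} \<and> H = {1, Suc 1}"
  then show ?thesis using that[of "-1" "-2"] coxeter_gens_val_refl(1) by (simp add: simple_pair_def)
next
  assume "s = adj_gen x \<and> 0 < x \<and> L = {x} \<and> H = {Suc x}"
  then show ?thesis using that[of "int x" "- (int x + 1)"] coxeter_gens_val_refl(2)
    by (simp add: simple_pair_def)
qed

text \<open>The label meets \<open>{x, Suc x}\<close> in \<open>L\<close> when \<open>f\<close> and
  \<open>g\<close> are entries, and in \<open>H\<close> when their negatives are. In the remaining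
  cases \<open>s \<circ> u\<close> is not dominant. The length excludes an edge in both
  directions.\<close>

lemma gen_action:
  assumes "gen_bits s x L H" "u \<in> dominant"
  shows "(u, s \<circ> u) \<in> edges \<longleftrightarrow> label u \<inter> {x, Suc x} = L"
    and "(s \<circ> u, u) \<in> edges \<longleftrightarrow> label u \<inter> {x, Suc x} = H"
    and "label u \<inter> {x, Suc x} = L \<Longrightarrow> gen_edge u s (s \<circ> u)"
    and "label u \<inter> {x, Suc x} = L \<or> label u \<inter> {x, Suc x} = H \<Longrightarrow>
      label (s \<circ> u) = sym_diff (label u) {x, Suc x}"
proof -
  obtain f g where fg: "simple_pair f g" and s: "s = val_refl (of_int f) (of_int g)"
    and bits: "f = -1 \<and> g = -2 \<and> x = 1 \<and> L = {} \<and> H = {1, Suc 1} \<or>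
      f = int x \<and> g = - (int x + 1) \<and> 0 < x \<and> L = {x} \<and> H = {Suc x}"
    using gen_bits_val_refl[OF assms(1)] .
  have u: "u \<in> alcoves" using assms by (simp add: dominant_alcove)
  note range = alcove_range_int[OF u]
  have "(of_int f \<in> range u \<longleftrightarrow> (x \<in> label u \<longleftrightarrow> L \<noteq> {})) \<and>
    (of_int (- f) \<in> range u \<longleftrightarrow> (x \<in> label u \<longleftrightarrow> L = {})) \<and>
    (of_int g \<in> range u \<longleftrightarrow> Suc x \<notin> label u) \<and> (of_int (- g) \<in> range u \<longleftrightarrow> Suc x \<in> label u)"
    using bits
  proof
    assume b: "f = -1 \<and> g = -2 \<and> x = 1 \<and> L = {} \<and> H = {1, Suc 1}"
    then show ?thesis
      using range[of f] range[of g] range[of "- f"] range[of "- g"] by (simp add: numeral_2_eq_2)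
  next
    assume b: "f = int x \<and> g = - (int x + 1) \<and> 0 < x \<and> L = {x} \<and> H = {Suc x}"
    then have "nat f = x" "nat (- g) = Suc x" by auto
    then show ?thesis
      using range[of f] range[of g] range[of "- f"] range[of "- g"] b by simp
  qed
  then have mem: "of_int f \<in> range u \<longleftrightarrow> (x \<in> label u \<longleftrightarrow> L \<noteq> {})"
    "of_int (- f) \<in> range u \<longleftrightarrow> (x \<in> label u \<longleftrightarrow> L = {})"
    "of_int g \<in> range u \<longleftrightarrow> Suc x \<notin> label u" "of_int (- g) \<in> range u \<longleftrightarrow> Suc x \<in> label u"
    by blast+
  have sets: "L = {} \<and> H = {x, Suc x} \<or> L = {x} \<and> H = {Suc x}" using bits by blast
  have L: "label u \<inter> {x, Suc x} = L \<longleftrightarrow> of_int f \<in> range u \<and> of_int g \<in> range u"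
    and H: "label u \<inter> {x, Suc x} = H \<longleftrightarrow> of_int (- f) \<in> range u \<and> of_int (- g) \<in> range u"
    using sets mem by auto
  have up: "gen_edge u s (s \<circ> u)" if "label u \<inter> {x, Suc x} = L"
    using val_refl_low[OF fg assms(2)] that L assms gen_bits_coxeter
    by (simp add: gen_edge_def s)
  then show "label u \<inter> {x, Suc x} = L \<Longrightarrow> gen_edge u s (s \<circ> u)" .
  have inv: "s \<circ> (s \<circ> u) = u"
    using fg by (auto simp: fun_eq_iff s val_refl_def simple_pair_def)
  have down: "gen_edge (s \<circ> u) s u" if "label u \<inter> {x, Suc x} = H"
    using val_refl_high[OF fg assms(2)] that H assms gen_bits_coxeter inv
    by (simp add: gen_edge_def s)
  have up': "(u, s \<circ> u) \<in> edges" if "label u \<inter> {x, Suc x} = L"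
    using up[OF that] by (auto simp: edges_def)
  have down': "(s \<circ> u, u) \<in> edges" if "label u \<inter> {x, Suc x} = H"
    using down[OF that] by (auto simp: edges_def)
  have edge_dominant: "v \<in> dominant \<and> w \<in> dominant" if "(v, w) \<in> edges" for v w
    using that by (auto simp: edges_def gen_edge_def)
  have none: "s \<circ> u \<notin> dominant" if "label u \<inter> {x, Suc x} \<noteq> L" "label u \<inter> {x, Suc x} \<noteq> H"
  proof -
    have "of_int z \<in> range u \<longleftrightarrow> of_int (- z) \<notin> range u" if "z \<noteq> 0" for z
      using alcove_range_int[OF u that] alcove_range_int[OF u, of "- z"] that by auto
    moreover have "f \<noteq> 0" "g \<noteq> 0" using fg by (auto simp: simple_pair_def)
    ultimately show ?thesis
      using val_refl_mixed[OF fg assms(2)] that L H unfolding s by metis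
  qed
  show "(u, s \<circ> u) \<in> edges \<longleftrightarrow> label u \<inter> {x, Suc x} = L"
    using up' down' none edge_dominant len_edge less_asym[of "len u" "len (s \<circ> u)"] by (metis lessI)
  show "(s \<circ> u, u) \<in> edges \<longleftrightarrow> label u \<inter> {x, Suc x} = H"
    using up' down' none edge_dominant len_edge less_asym[of "len u" "len (s \<circ> u)"] by (metis lessI)
  show "label (s \<circ> u) = sym_diff (label u) {x, Suc x}"
    if LH: "label u \<inter> {x, Suc x} = L \<or> label u \<inter> {x, Suc x} = H"
  proof (rule Set.set_eqI)
    \<comment> \<open>The generator exchanges the bits at \<open>x\<close> and \<open>Suc x\<close>,
      and \<open>neg_gen\<close> also inverts them. As the bits differ in the first case and agree
      in the second, both are simply inverted.\<close>
    have bit: "(x \<in> label u \<longleftrightarrow> Suc x \<in> label u) \<longleftrightarrow> L = {}"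
      using sets
    proof
      assume "L = {} \<and> H = {x, Suc x}"
      then show ?thesis using LH by blast
    next
      assume LH': "L = {x} \<and> H = {Suc x}"
      have "(x \<in> X) \<noteq> (Suc x \<in> X)" if "X = {x} \<or> X = {Suc x}" for X
        using that by auto
      from this[OF LH[unfolded LH'[THEN conjunct1] LH'[THEN conjunct2]]]
      have "(x \<in> label u) \<noteq> (Suc x \<in> label u)" by blast
      then show ?thesis using LH' by blast
    qed
    fix n
    show "n \<in> label (s \<circ> u) \<longleftrightarrow> n \<in> sym_diff (label u) {x, Suc x}"
    proof (cases "0 < n")
      case True
      then have "n \<in> label (s \<circ> u) \<longleftrightarrow> of_int (val_refl f g (int n)) \<in> range u"
        using val_refl_range[OF fg, of "int n" u] by (simp add: label_def s)
      also have "\<dots> \<longleftrightarrow> n \<in> sym_diff (label u) {x, Suc x}"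
      proof -
        note shift = val_refl_shift[OF fg, of "int n"]
        consider "int n = f" "n = x" "L = {x}" "H = {Suc x}" | "int n = - f" "n = x" "L = {}" "H = {x, Suc x}"
          | "int n = - g" "n = Suc x" | "int n \<notin> {f, g, - f, - g}" "n \<noteq> x" "n \<noteq> Suc x"
          using bits True by force
        then show ?thesis
        proof cases
          case 1
          then have v: "val_refl f g (int n) = - g" using shift(1) by simp
          show ?thesis unfolding v mem using bit 1(2,3) by simp
        next
          case 2
          then have v: "val_refl f g (int n) = g" using shift(2) by simp
          show ?thesis unfolding v mem using bit 2(2,3) by simp
        next
          case 3
          then have v: "val_refl f g (int n) = f" using shift(2) by simp
          show ?thesis unfolding v mem using bit 3(2) by auto
        next
          case 4
          then have v: "val_refl f g (int n) = int n" using shift(3) by simp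
          show ?thesis unfolding v using range[of "int n"] 4(2,3) True by simp
        qed
      qed
      finally show ?thesis .
    next
      case False
      then show ?thesis using bits by (auto simp: label_def)
    qed
  qed
qed

section \<open>The recursion\<close>

text \<open>A label without a 01 at positive positions is an initial segment
  \<open>{1, ..., n}\<close>; if it is non-empty, its even order forces it to contain 1 and
  2.\<close>

lemma P_even_predecessor:
  assumes "a \<in> P_even" "a \<noteq> {}"
  shows "\<exists>s x L H. gen_bits s x L H \<and> a \<inter> {x, Suc x} = H"
proof (cases "\<exists>x. 0 < x \<and> Suc x \<in> a \<and> x \<notin> a")
  case True
  then obtain x where "0 < x" "Suc x \<in> a" "x \<notin> a" by blast
  then have "gen_bits (adj_gen x) x {x} {Suc x}" "a \<inter> {x, Suc x} = {Suc x}"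
    by (auto simp: gen_bits_def)
  then show ?thesis by blast
next
  case False
  have a: "finite a" "0 \<notin> a" "even (card a)" using assms(1) by (auto simp: P_even_def)
  have "card a \<noteq> 0" using a(1) assms(2) by simp
  then have "a \<noteq> {1}" using a(3) by auto
  then obtain n where "n \<in> a" "n \<noteq> 1" using assms(2) by blast
  moreover have "n \<noteq> 0" using a(2) calculation by metis
  ultimately have "Suc 1 \<le> n" "n \<in> a" by auto
  then have "Suc 1 \<in> a"
  proof (induction n rule: dec_induct)
    case (step m)
    then show ?case using False by force
  qed simp
  moreover have "1 \<in> a" using False calculation by force
  ultimately have "gen_bits neg_gen 1 {} {1, Suc 1}" "a \<inter> {1, Suc 1} = {1, Suc 1}"
    by (auto simp: gen_bits_def)
  then show ?thesis by blast
qed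

text \<open>The sum is the measure of the main induction; going down an edge lowers it by 3 for
  \<open>neg_gen\<close> and by 1 otherwise.\<close>

lemma P_even_step:
  assumes "gen_bits s x L H" "a \<in> P_even" "a \<inter> {x, Suc x} = H"
  defines "b \<equiv> sym_diff a {x, Suc x}"
  shows "b \<in> P_even" "\<Sum> b < \<Sum> a" "b \<inter> {x, Suc x} = L"
proof -
  have a: "finite a" "0 \<notin> a" "even (card a)" using assms(2) by (auto simp: P_even_def)
  have "(b \<in> P_even \<and> \<Sum> b < \<Sum> a) \<and> b \<inter> {x, Suc x} = L"
    using assms(1) unfolding gen_bits_def
  proof
    assume g: "s = neg_gen \<and> x = 1 \<and> L = {} \<and> H = {1, Suc 1}"
    then have sub: "{1, Suc 1} \<subseteq> a" using assms(3) by blast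
    then have b: "b = a - {1, Suc 1}" using g by (auto simp: b_def)
    have "\<Sum> a = \<Sum> b + \<Sum> {1, Suc 1}"
      unfolding b using sum.subset_diff[OF sub a(1), of "\<lambda>n. n"] by simp
    moreover have "card b = card a - 2" unfolding b using sub a(1) by (subst card_Diff_subset) auto
    ultimately show ?thesis using a g by (auto simp: P_even_def b)
  next
    assume g: "s = adj_gen x \<and> 0 < x \<and> L = {x} \<and> H = {Suc x}"
    then have "a \<inter> {x, Suc x} = {Suc x}" using assms(3) by simp
    then have "Suc x \<in> a \<inter> {x, Suc x}" "x \<notin> a \<inter> {x, Suc x}" by simp_all
    then have x: "Suc x \<in> a" "x \<notin> a" by simp_all
    then have b: "b = insert x (a - {Suc x})" by (auto simp: b_def)
    have "\<Sum> a = Suc x + \<Sum> (a - {Suc x})"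
      using x a(1) by (simp add: sum.remove)
    moreover have "\<Sum> b = x + \<Sum> (a - {Suc x})" unfolding b using x a(1) by simp
    moreover have "card b = card a"
      using card_insert_disjoint[of "a - {Suc x}" x] card_Suc_Diff1[OF a(1) x(1)] x(2) a(1)
      unfolding b by (metis DiffD1 finite_Diff)
    ultimately show ?thesis using a g by (auto simp: P_even_def b)
  qed
  then show "b \<in> P_even" "\<Sum> b < \<Sum> a" "b \<inter> {x, Suc x} = L" by auto
qed

lemma caps_step:
  assumes "gen_bits s x L H" "caps b \<sigma>" "b \<inter> {x, Suc x} = L"
  shows "\<sigma> x \<noteq> Suc x \<and> caps (sym_diff b {x, Suc x}) (rewire x (Suc x) \<sigma>)"
  using assms(1) unfolding gen_bits_def
proof
  assume g: "s = neg_gen \<and> x = 1 \<and> L = {} \<and> H = {1, Suc 1}"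
  then have b: "1 \<notin> b" "Suc 1 \<notin> b" using assms(3) by auto
  then have "sym_diff b {1, Suc 1} = insert 1 (insert 2 b)" by auto
  then show ?thesis using caps_add[OF assms(2)] b g by (simp add: numeral_2_eq_2)
next
  assume g: "s = adj_gen x \<and> 0 < x \<and> L = {x} \<and> H = {Suc x}"
  then have "b \<inter> {x, Suc x} = {x}" using assms(3) by simp
  then have "x \<in> b \<inter> {x, Suc x}" "Suc x \<notin> b \<inter> {x, Suc x}" by simp_all
  then have b: "x \<in> b" "Suc x \<notin> b" by simp_all
  then have "sym_diff b {x, Suc x} = insert (Suc x) (b - {x})" by auto
  then show ?thesis using caps_shift[OF assms(2), of x] b g by simp
qed

text \<open>By \<open>saturated_insert_rewire\<close> at most one term on each left-hand side is
  non-zero. The factor \<open>vv\<close> or \<open>vv_inv\<close> accounts for the one arc by which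
  the depths of \<open>N\<close> and of \<open>N\<close> with \<open>x\<close>, \<open>y\<close>
  added differ.\<close>

lemma weight_step:
  assumes "caps b \<sigma>" "finite b" "\<sigma> x \<noteq> y" "x \<noteq> y" "x \<notin> N" "y \<notin> N"
  shows "vv * weight \<sigma> N + weight \<sigma> (insert x (insert y N)) =
      weight (rewire x y \<sigma>) (insert x (insert y N))"
    and "vv_inv * weight \<sigma> (insert x (insert y N)) + weight \<sigma> N = weight (rewire x y \<sigma>) N"
proof -
  interpret caps b \<sigma> by fact
  note sat = saturated_insert_rewire[of \<sigma>, OF inv assms(3-)]
  have card: "card (insert x (insert y N)) div 2 = Suc (card N div 2)"
    if "saturated \<sigma> N \<or> saturated \<sigma> (insert x (insert y N))"
  proof -
    have "finite N"
      using that finite_saturated[OF assms(2), of N]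
        finite_saturated[OF assms(2), of "insert x (insert y N)"] by auto
    then show ?thesis using assms(4-) by simp
  qed
  have vv: "vv_inv * (vv * y) = y" for y
    using vv_mult_inv by (simp flip: mult.assoc)
  show "vv * weight \<sigma> N + weight \<sigma> (insert x (insert y N)) =
      weight (rewire x y \<sigma>) (insert x (insert y N))"
    using sat card by (auto simp: weight_def)
  show "vv_inv * weight \<sigma> (insert x (insert y N)) + weight \<sigma> N = weight (rewire x y \<sigma>) N"
    using sat card by (auto simp: weight_def vv)
qed

lemma pre_row_weight:
  assumes bits: "gen_bits s x L H" and "caps b \<sigma>" "finite b" "b \<inter> {x, Suc x} = L" "D \<in> dominant"
    and f: "\<And>E. E \<in> dominant \<Longrightarrow> f E = weight \<sigma> (sym_diff b (label E))"
  defines "a \<equiv> sym_diff b {x, Suc x}"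
  shows "pre_row s f D = weight (rewire x (Suc x) \<sigma>) (sym_diff a (label D))"
proof -
  define y d where "y = Suc x" and "d = label D"
  have \<sigma>: "\<sigma> x \<noteq> y" using caps_step[OF assms(1,2,4)] by (simp add: y_def)
  have xy: "x \<noteq> y" by (simp add: y_def)
  have LH: "L = {} \<and> H = {x, y} \<or> L = {x} \<and> H = {y}" using bits by (auto simp: gen_bits_def y_def)
  note act = gen_action[OF bits \<open>D \<in> dominant\<close>, folded y_def d_def]
  have dom: "s \<circ> D \<in> dominant" if "(D, s \<circ> D) \<in> edges \<or> (s \<circ> D, D) \<in> edges"
    using that by (auto simp: edges_def gen_edge_def)
  have b: "b \<inter> {x, y} = L" using assms by (simp add: y_def)
  note step = weight_step[OF assms(2,3) \<sigma> xy]
  \<comment> \<open>Only \<open>x\<close> and \<open>y\<close> are at stake: each symmetric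
    difference in the first two cases is \<open>N\<close> or \<open>N\<close> with both
    added.\<close>
  define N where "N = sym_diff b d - {x, y}"
  have N: "x \<notin> N" "y \<notin> N" by (auto simp: N_def)
  have bx: "x \<in> b \<longleftrightarrow> L \<noteq> {}" "y \<notin> b" using b LH xy by auto
  have a: "a = sym_diff b {x, y}" by (simp add: a_def y_def)
  consider (low) "d \<inter> {x, y} = L" | (high) "d \<inter> {x, y} = H" "d \<inter> {x, y} \<noteq> L"
    | (mixed) "d \<inter> {x, y} \<noteq> L" "d \<inter> {x, y} \<noteq> H" by blast
  then show ?thesis
  proof cases
    case low
    then have dx: "x \<in> d \<longleftrightarrow> L \<noteq> {}" "y \<notin> d" using LH xy by auto
    have sets: "sym_diff b d = N" "sym_diff b (sym_diff d {x, y}) = insert x (insert y N)"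
      "sym_diff a d = insert x (insert y N)"
      using dx bx by (auto simp: N_def a)
    have "pre_row s f D = vv * f D + f (s \<circ> D)" using act(1) low by (simp add: pre_row_def)
    also have "f D = weight \<sigma> N" using f[OF \<open>D \<in> dominant\<close>] sets by (simp add: d_def)
    also have "f (s \<circ> D) = weight \<sigma> (insert x (insert y N))"
      using f[of "s \<circ> D"] dom act(1,4) low sets by simp
    finally show ?thesis using step(1)[OF N] sets by (simp add: y_def d_def)
  next
    case high
    then have dx: "x \<in> d \<longleftrightarrow> L = {}" "y \<in> d" using LH xy by auto
    have sets: "sym_diff b d = insert x (insert y N)" "sym_diff b (sym_diff d {x, y}) = N"
      "sym_diff a d = N"
      using dx bx by (auto simp: N_def a)
    have "pre_row s f D = vv_inv * f D + f (s \<circ> D)" using act(1,2) high by (simp add: pre_row_def)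
    also have "f D = weight \<sigma> (insert x (insert y N))"
      using f[OF \<open>D \<in> dominant\<close>] sets by (simp add: d_def)
    also have "f (s \<circ> D) = weight \<sigma> N"
      using f[of "s \<circ> D"] dom act(2,4) high sets by simp
    finally show ?thesis using step(2)[OF N] sets by (simp add: y_def d_def)
  next
    \<comment> \<open>Exactly one end of the new arc lies in the symmetric difference, so its weight
      is 0, in agreement with the default value of \<open>pre_row\<close>.\<close>
    case mixed
    then have "x \<in> sym_diff a d \<longleftrightarrow> y \<notin> sym_diff a d"
      using LH xy bx by (auto simp: a)
    moreover have "rewire x y \<sigma> x = y" "rewire x y \<sigma> y = x"
      using xy by (auto simp: rewire_def)
    ultimately have "\<not> saturated (rewire x y \<sigma>) (sym_diff a d)"
      unfolding saturated_def by metis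
    then show ?thesis using act(1,2) mixed by (simp add: pre_row_def weight_def y_def d_def)
  qed
qed

text \<open>The induction hypothesis is used twice: for a lower neighbour \<open>B\<close> of our
  choice, from which the alcove \<open>A\<close> is built, and for the lower end \<open>C\<close> of
  \<open>chosen_edge A\<close>, from which \<open>kl\<close> computes its row. By
  \<open>dominant_eqI\<close> the alcove supplied for the label of \<open>C\<close> is
  \<open>C\<close> itself.\<close>

lemma kl_weight:
  assumes "a \<in> P_even"
  shows "\<exists>A\<in>dominant. label A = a \<and>
    (\<exists>\<tau>. caps a \<tau> \<and> (\<forall>D\<in>dominant. kl A D = weight \<tau> (sym_diff a (label D))))"
  using assms
proof (induction "\<Sum> a" arbitrary: a rule: less_induct)
  case less
  show ?case
  proof (cases "a = {}")
    case True
    have "caps {} (\<lambda>k. k)" by unfold_locales auto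
    moreover have "kl root_alcove D = weight (\<lambda>k. k) (label D)" if "D \<in> dominant" for D
    proof -
      have "D = root_alcove \<longleftrightarrow> label D = {}"
        using dominant_eqI[OF that root_dominant] label_root by auto
      then show ?thesis
        by (auto simp: kl.simps[of root_alcove] weight_def saturated_def)
    qed
    ultimately show ?thesis using True root_dominant label_root
      by (intro bexI[of _ root_alcove] conjI exI[of _ "\<lambda>k. k"]) auto
  next
    case False
    have "finite a" using less.prems by (simp add: P_even_def)
    obtain s x L H where s: "gen_bits s x L H" "a \<inter> {x, Suc x} = H"
      using P_even_predecessor[OF less.prems False] by metis
    note b = P_even_step[OF s(1) less.prems s(2)]
    obtain B where B: "B \<in> dominant" "label B = sym_diff a {x, Suc x}"
      using less.hyps[OF b(2,1)] by blast
    define A where "A = s \<circ> B"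
    have edge: "gen_edge B s A" using gen_action(3)[OF s(1) B(1)] b(3) B(2) by (simp add: A_def)
    then have A: "A \<in> dominant" unfolding gen_edge_def by blast
    have lab: "label A = a"
      using gen_action(4)[OF s(1) B(1)] b(3) B(2) by (auto simp: A_def)
    obtain C t where C: "chosen_edge A = (C, t)" by (cases "chosen_edge A")
    have Ct: "gen_edge C t A" using chosen_edge[of A] edge C by auto
    then have "t \<in> coxeter_gens" unfolding gen_edge_def by blast
    then obtain z K M where t: "gen_bits t z K M" using coxeter_gens_bits by blast
    have C': "C \<in> dominant" "A = t \<circ> C" "(C, A) \<in> edges"
      using Ct by (auto simp: gen_edge_def edges_def)
    have K: "label C \<inter> {z, Suc z} = K" using gen_action(1)[OF t C'(1)] C' by simp
    have aC: "a = sym_diff (label C) {z, Suc z}"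
      using gen_action(4)[OF t C'(1)] C'(2) K lab by simp
    then have Ca: "label C = sym_diff a {z, Suc z}" by blast
    have M: "a \<inter> {z, Suc z} = M"
    proof -
      have "a \<inter> {z, Suc z} = {z, Suc z} - (label C \<inter> {z, Suc z})" unfolding aC by blast
      also have "\<dots> = M"
        unfolding K using t unfolding gen_bits_def by (elim disjE conjE) (simp_all add: insert_Diff_if)
      finally show ?thesis .
    qed
    note c = P_even_step[OF t less.prems M, folded Ca]
    obtain \<sigma> where \<sigma>: "caps (label C) \<sigma>"
      "\<And>D. D \<in> dominant \<Longrightarrow> kl C D = weight \<sigma> (sym_diff (label C) (label D))"
      using less.hyps[OF c(2,1)] dominant_eqI[OF C'(1)] by metis
    define \<tau> where "\<tau> = rewire z (Suc z) \<sigma>"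
    have \<tau>: "caps a \<tau>" using caps_step[OF t \<sigma>(1) K] by (simp add: aC \<tau>_def)
    have row: "pre_row t (kl C) D = weight \<tau> (sym_diff a (label D))" if "D \<in> dominant" for D
      using pre_row_weight[OF t \<sigma>(1) _ K that \<sigma>(2)] c(1)
      by (simp add: P_even_def \<tau>_def flip: aC)
    \<comment> \<open>The length separates \<open>E\<close> from \<open>A\<close>, so the labels
      differ and the weight has no constant term.\<close>
    have correction: "at_v0 (pre_row t (kl C) E) = 0" if "E \<in> below A" for E
    proof -
      have "E \<in> dominant"
        using that tranclD[of E A edges] by (auto simp: below_def edges_def gen_edge_def)
      moreover have "E \<noteq> A" using len_less_if_below[OF that] by auto
      ultimately have "label E \<noteq> a" using dominant_eqI A lab by blast
      then have "sym_diff a (label E) \<noteq> {}" by blast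
      then show ?thesis
        using row[OF \<open>E \<in> dominant\<close>] caps.at_v0_weight[OF \<tau> \<open>finite a\<close>] by simp
    qed
    have "A \<noteq> root_alcove" using lab False label_root by auto
    then have "kl A D = pre_row t (kl C) D" for D
      using edge correction by (subst kl.simps) (auto simp: C Let_def)
    then show ?thesis using A lab \<tau> row by metis
  qed
qed

theorem theorem10p6:
  fixes a b :: "nat set"
  assumes "a \<in> P_even" and "b \<in> P_even"
  shows "kl_poly a b = hypercube a b"
proof -
  obtain A \<tau> where A: "A \<in> dominant" "label A = a" "caps a \<tau>"
    "\<And>D. D \<in> dominant \<Longrightarrow> kl A D = weight \<tau> (sym_diff a (label D))"
    using kl_weight[OF assms(1)] by blast
  obtain B where B: "B \<in> dominant" "label B = b" using kl_weight[OF assms(2)] by blast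
  have "kl_poly a b = kl A B"
    using alcove_of_label A(1,2) B by (auto simp: kl_poly_def)
  also have "\<dots> = hypercube a b"
    using caps.hypercube_eq_weight[OF A(3), of b] A(4)[OF B(1)] B(2) assms by (simp add: P_even_def)
  finally show ?thesis .
qed

end
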